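(* Let $1\le l<d$ be integers, put $k=d-l$, let $L$ be a Banach limit, and let $A$ be a non-invertible positive semi-definite $d\times d$ complex matrix. The following statements are equivalent: (i) there exists an $l$-stable powerbounded $d\times d$ complex matrix $T$ such that $A_{T,C}=A$; (ii) there exists an $l$-stable powerbounded $d\times d$ complex matrix $T$ such that $A_{T,L}=A$; (iii) $A$ has exactly $k$ non-zero eigenvalues $t_1,\dots,t_k$, counted with multiplicity, and $$\frac1{t_1}+\dots+\frac1{t_k}\le k;$$ (iv) there exists an invertible $d\times d$ complex matrix $S$ whose column vectors are all unit vectors such that $$A=(S^{*})^{-1}(I_k\oplus 0_l)S^{-1}.$$
   Context: $\mathbb{C}^d$ carries the usual inner product; matrices are identified with operators on $\mathbb{C}^d$. A matrix $T$ is powerbounded if there is $M>0$ with $\|T^n\|<M$ for all $n\in\mathbb{N}=\{1,2,\dots\}$ (operator norm). A Banach limit is a bounded linear functional $L:\ell^\infty\to\mathbb{C}$ on bounded complex sequences such that $\|L\|=1$, $L(x)=\lim_n x_n$ for every convergent sequence $x$, $L$ is positive ($x_n\ge 0$ for all $n$ implies $L(x)\ge0$), and $L$ is shift-invariant ($L((x_n)_n)=L((x_{n+1})_n)$). For powerbounded $T$ and a Banach limit $L$, the $L$-asymptotic limit $A_{T,L}$ is the unique positive operator with $\langle A_{T,L}x,y\rangle = L\big((\langle T^nx,T^ny\rangle)_{n\ge1}\big)$ for all $x,y$ (for matrices: the entrywise $L$-limit of $T^{*n}T^n$). The Cesàro asymptotic limit of a matrix $T$ is $A_{T,C}=\lim_{n\to\infty}\frac1n\sum_{j=1}^n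 T^{*j}T^j$ (entrywise limit), if this limit exists. The stable subspace of a powerbounded $T$ is $\mathcal{H}_0(T)=\ker A_{T,L}=\{x: T^nx\to0\}$. A powerbounded $d\times d$ matrix $T$ is called $l$-stable if $\dim\mathcal{H}_0(T)=l$. $I_k$ is the $k\times k$ identity matrix, $0_l$ the $l\times l$ zero matrix, and $\oplus$ denotes the block-diagonal (orthogonal) sum. *)

theory Defs
  imports
    "Jordan_Normal_Form.Schur_Decomposition"
    "Jordan_Normal_Form.Matrix_Kernel"
    "Jordan_Normal_Form.Char_Poly"
    "HOL-Library.Complex_Order"
begin

(* The inner product of x and y is x \<bullet>c y, which is linear in x and conjugate-linear in y.
   On complex numbers, 0 \<le> z means that z is real and non-negative. *)

definition cvec_norm :: "complex vec \<Rightarrow> real" where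
  "cvec_norm x = sqrt (Re (x \<bullet>c x))"

definition op_norm :: "complex mat \<Rightarrow> real" where
  "op_norm T = (SUP x \<in> {x \<in> carrier_vec (dim_col T). cvec_norm x \<le> 1}. cvec_norm (T *\<^sub>v x))"

definition powerbounded :: "complex mat \<Rightarrow> bool" where
  "powerbounded T \<longleftrightarrow> (\<exists>M>0. \<forall>n\<ge>1. op_norm (T ^\<^sub>m n) < M)"

(* As for operators on a complex space, self-adjointness is implied. *)
definition pos_semidef :: "nat \<Rightarrow> complex mat \<Rightarrow> bool" where
  "pos_semidef d A \<longleftrightarrow>
     A \<in> carrier_mat d d \<and> (\<forall>x \<in> carrier_vec d. 0 \<le> (A *\<^sub>v x) \<bullet>c x)"

definition sup_norm :: "(nat \<Rightarrow> complex) \<Rightarrow> real" where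
  "sup_norm x = (SUP n. cmod (x n))"

(* A functional on the bounded sequences is a function on all sequences, whose values at
   unbounded sequences are irrelevant.  Sequences indexed by 1, 2, ... are shifted to start at
   index 0.  The existence of a bound is stated separately because SUP is only meaningful for
   sets of reals that are bounded above. *)
definition banach_limit :: "((nat \<Rightarrow> complex) \<Rightarrow> complex) \<Rightarrow> bool" where
  "banach_limit L \<longleftrightarrow>
     (\<forall>x y. Bseq x \<longrightarrow> Bseq y \<longrightarrow> L (\<lambda>n. x n + y n) = L x + L y) \<and>
     (\<forall>c x. Bseq x \<longrightarrow> L (\<lambda>n. c * x n) = c * L x) \<and>
     (\<exists>K. \<forall>x. Bseq x \<longrightarrow> cmod (L x) \<le> K * sup_norm x) \<and>
     (SUP x \<in> {x. Bseq x \<and> sup_norm x \<le> 1}. cmod (L x)) = 1 \<and>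
     (\<forall>x a. x \<longlonglongrightarrow> a \<longrightarrow> L x = a) \<and>
     (\<forall>x. Bseq x \<longrightarrow> (\<forall>n. 0 \<le> x n) \<longrightarrow> 0 \<le> L x) \<and>
     (\<forall>x. Bseq x \<longrightarrow> L (\<lambda>n. x (Suc n)) = L x)"

(* The exponent is Suc n because powers start at 1. *)
definition asymptotic_limit :: "((nat \<Rightarrow> complex) \<Rightarrow> complex) \<Rightarrow> complex mat \<Rightarrow> complex mat" where
  "asymptotic_limit L T =
     (THE A. pos_semidef (dim_row T) A \<and>
        (\<forall>x \<in> carrier_vec (dim_row T). \<forall>y \<in> carrier_vec (dim_row T).
           (A *\<^sub>v x) \<bullet>c y = L (\<lambda>n. (T ^\<^sub>m Suc n *\<^sub>v x) \<bullet>c (T ^\<^sub>m Suc n *\<^sub>v y))))"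

(* The limit exists and equals A. *)
definition has_cesaro_asymptotic_limit :: "complex mat \<Rightarrow> complex mat \<Rightarrow> bool" where
  "has_cesaro_asymptotic_limit T A \<longleftrightarrow>
     A \<in> carrier_mat (dim_row T) (dim_row T) \<and>
     (\<forall>p < dim_row T. \<forall>q < dim_row T.
        (\<lambda>n. 1 / of_nat n * (\<Sum>j=1..n. (mat_adjoint T ^\<^sub>m j * T ^\<^sub>m j) $$ (p, q)))
          \<longlonglongrightarrow> A $$ (p, q))"

definition stable_subspace :: "complex mat \<Rightarrow> complex vec set" where
  "stable_subspace T =
     {x \<in> carrier_vec (dim_row T). (\<lambda>n. cvec_norm (T ^\<^sub>m n *\<^sub>v x)) \<longlonglongrightarrow> 0}"

definition subspace_dim :: "nat \<Rightarrow> complex vec set \<Rightarrow> nat" where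
  "subspace_dim d W =
     vectorspace.dim class_ring ((module_vec TYPE(complex) d)\<lparr>carrier := W\<rparr>)"

(* Used for powerbounded T only. *)
definition l_stable :: "nat \<Rightarrow> complex mat \<Rightarrow> bool" where
  "l_stable l T \<longleftrightarrow> subspace_dim (dim_row T) (stable_subspace T) = l"

(* Only meaningful for invertible matrices. *)
definition mat_inv :: "complex mat \<Rightarrow> complex mat" where
  "mat_inv S = the (mat_inverse S)"

(* Multiplicities are algebraic. *)
definition nonzero_eigenvalues :: "complex mat \<Rightarrow> complex multiset" where
  "nonzero_eigenvalues A = {# t \<in># proots (char_poly A). t \<noteq> 0 #}"

end

theory Submission
  imports Defs "HOL-Analysis.L2_Norm"
begin

text \<open>Banach limits and Cesaro means are both shift-invariant positive means of sequences for which
  the powers of a unimodular number other than 1 have mean 0. Let \<open>A\<close> be the mean of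
  \<open>T\<^sup>*\<^sup>n T\<^sup>n\<close> for such a mean. Shift invariance gives \<open>T\<^sup>* A T = A\<close>.

  Let \<open>u\<^sub>1, \<dots>, u\<^sub>k\<close> be orthonormal eigenvectors of \<open>A\<close> for its nonzero eigenvalues \<open>t\<^sub>a\<close>, and put
  \<open>w\<^sub>a = u\<^sub>a / sqrt t\<^sub>a\<close>. The component of \<open>T\<^sup>n w\<^sub>a\<close> in the span of \<open>w\<^sub>1, \<dots>, w\<^sub>k\<close> has as coefficients
  the \<open>a\<close>-th column of a \<open>k \<times> k\<close> matrix, which is unitary because \<open>T\<^sup>n\<close> preserves the form of \<open>A\<close>. Its
  rows being unit vectors as well, \<open>\<Sum>\<^sub>a \<parallel>T\<^sup>n w\<^sub>a\<parallel>\<^sup>2 \<ge> \<Sum>\<^sub>b 1 / t\<^sub>b\<close> for all \<open>n\<close>, and taking means gives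
  \<open>k \<ge> \<Sum>\<^sub>b 1 / t\<^sub>b\<close>.

  Conversely, if \<open>\<Sum>\<^sub>b 1 / t\<^sub>b \<le> k\<close>, combine the \<open>w\<^sub>a\<close> by the \<open>k \<times> k\<close> unitary Fourier matrix. The resulting
  vectors all have the same norm, which is at most 1, so that adding a suitable vector of the kernel of
  \<open>A\<close> turns them into unit vectors; these are the first \<open>k\<close> columns of \<open>S\<close>. Given \<open>S\<close>, let \<open>T\<close> have the
  first \<open>k\<close> columns of \<open>S\<close> as eigenvectors for the \<open>k\<close>-th roots of unity, and vanish on the others.\<close>

section \<open>Adjoints and norms\<close>

lemma dim_mat_adjoint [simp]:
  "dim_row (mat_adjoint A) = dim_col A" "dim_col (mat_adjoint A) = dim_row A"
  by (simp_all add: mat_adjoint_def)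

lemma mat_adjoint_carrier [simp, intro]:
  "A \<in> carrier_mat m n \<Longrightarrow> mat_adjoint A \<in> carrier_mat n m"
  by (metis carrier_matD carrier_matI dim_mat_adjoint)

lemma index_mat_adjoint [simp]:
  "i < dim_col A \<Longrightarrow> j < dim_row A \<Longrightarrow> mat_adjoint A $$ (i, j) = conjugate (A $$ (j, i))"
  by (simp add: mat_adjoint_def mat_of_rows_index)

lemma mat_adjoint_adjoint [simp]: "mat_adjoint (mat_adjoint A) = A"
  by (rule eq_matI) auto

lemma mat_adjoint_one [simp]: "mat_adjoint (1\<^sub>m n :: complex mat) = 1\<^sub>m n"
  by (rule eq_matI) auto

lemma mat_adjoint_mult:
  fixes A B :: "complex mat"
  assumes "A \<in> carrier_mat m n" "B \<in> carrier_mat n p"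
  shows "mat_adjoint (A * B) = mat_adjoint B * mat_adjoint A"
  using assms by (intro eq_matI) (auto simp: scalar_prod_def mult.commute)

lemma cscalar_prod_sum: "x \<in> carrier_vec n \<Longrightarrow> y \<in> carrier_vec n \<Longrightarrow>
    x \<bullet>c y = (\<Sum>i<n. x $ i * cnj (y $ i))"
  by (auto simp: scalar_prod_def lessThan_atLeast0)

lemma mult_mat_vec_cscalar_prod:
  fixes A :: "complex mat"
  assumes A: "A \<in> carrier_mat m n" and x: "x \<in> carrier_vec n" and y: "y \<in> carrier_vec m"
  shows "(A *\<^sub>v x) \<bullet>c y = (\<Sum>i<m. \<Sum>j<n. A $$ (i, j) * x $ j * cnj (y $ i))"
proof -
  have "(A *\<^sub>v x) \<bullet>c y = (\<Sum>i<m. (A *\<^sub>v x) $ i * cnj (y $ i))"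
    using assms by (intro cscalar_prod_sum) auto
  also have "\<dots> = (\<Sum>i<m. \<Sum>j<n. A $$ (i, j) * x $ j * cnj (y $ i))"
    using assms by (intro sum.cong refl) (auto simp: scalar_prod_def sum_distrib_right lessThan_atLeast0)
  finally show ?thesis .
qed

lemma cscalar_prod_adjoint:
  fixes A :: "complex mat"
  assumes A: "A \<in> carrier_mat m n" and x: "x \<in> carrier_vec n" and y: "y \<in> carrier_vec m"
  shows "(A *\<^sub>v x) \<bullet>c y = x \<bullet>c (mat_adjoint A *\<^sub>v y)"
proof -
  have "x \<bullet>c (mat_adjoint A *\<^sub>v y) = (\<Sum>j<n. x $ j * cnj ((mat_adjoint A *\<^sub>v y) $ j))"
    using assms by (intro cscalar_prod_sum) (auto intro!: carrier_vecI)
  also have "\<dots> = (\<Sum>j<n. \<Sum>i<m. A $$ (i, j) * x $ j * cnj (y $ i))"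
    using assms by (intro sum.cong refl) 
      (auto simp: scalar_prod_def sum_distrib_left lessThan_atLeast0 ac_simps)
  also have "\<dots> = (A *\<^sub>v x) \<bullet>c y"
    unfolding mult_mat_vec_cscalar_prod[OF assms] by (rule sum.swap)
  finally show ?thesis ..
qed

text \<open>Turns the inner product of two orbit vectors into a form, so that the entries of
  \<open>mat_adjoint (T ^\<^sub>m n) * T ^\<^sub>m n\<close> control it. Allowing two different
  matrices also covers forms of factored matrices.\<close>

lemma cscalar_prod_adjoint':
  fixes A B :: "complex mat"
  assumes A: "A \<in> carrier_mat m n" and B: "B \<in> carrier_mat m p" and "x \<in> carrier_vec n" "y \<in> carrier_vec p"
  shows "(A *\<^sub>v x) \<bullet>c (B *\<^sub>v y) = ((mat_adjoint B * A) *\<^sub>v x) \<bullet>c y"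
  using assms cscalar_prod_adjoint[of "mat_adjoint B" p m "A *\<^sub>v x" y]
  by (subst assoc_mult_mat_vec[where n\<^sub>2 = m and n\<^sub>3 = n]) auto

lemma cscalar_prod_unit_vec:
  assumes "A \<in> carrier_mat m n" "i < m" "j < n"
  shows "(A *\<^sub>v unit_vec n j) \<bullet>c unit_vec m i = (A $$ (i, j) :: complex)"
proof -
  have "(A *\<^sub>v unit_vec n j) \<bullet>c unit_vec m i = 
      (\<Sum>p<m. \<Sum>q<n. if p = i then (if q = j then A $$ (p, q) else 0) else 0)"
    using assms by (subst mult_mat_vec_cscalar_prod) (auto intro!: sum.cong)
  also have "\<dots> = (\<Sum>p<m. if p = i then (\<Sum>q<n. (if q = j then A $$ (p, q) else 0)) else 0)"
    by (intro sum.cong) auto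
  also have "\<dots> = A $$ (i, j)"
    using assms by (simp add: sum.delta)
  finally show ?thesis .
qed

text \<open>Unit vectors pick out the entries. This yields uniqueness of limits and turns identities
  between forms, such as invariance under powers of \<open>T\<close>, into matrix
  identities.\<close>

lemma mat_eq_by_form:
  fixes A B :: "complex mat"
  assumes A: "A \<in> carrier_mat m n" and B: "B \<in> carrier_mat m n" 
    and eq: "\<And>x y. x \<in> carrier_vec n \<Longrightarrow> y \<in> carrier_vec m \<Longrightarrow> (A *\<^sub>v x) \<bullet>c y = (B *\<^sub>v x) \<bullet>c y"
  shows "A = B"
proof (rule eq_matI)
  fix i j assume "i < dim_row B" "j < dim_col B"
  then show "A $$ (i, j) = B $$ (i, j)"
    using cscalar_prod_unit_vec[OF A, of i j] cscalar_prod_unit_vec[OF B, of i j] eq B by simp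
qed (use A B in auto)

section \<open>Euclidean norm, operator norm and powerboundedness\<close>

lemma cvec_norm_L2_set: "x \<in> carrier_vec n \<Longrightarrow> cvec_norm x = L2_set (\<lambda>i. cmod (x $ i)) {..<n}"
  unfolding cvec_norm_def L2_set_def
  by (simp add: cscalar_prod_sum complex_mult_cnj cmod_power2)

lemma cvec_norm_nonneg [simp]: "0 \<le> cvec_norm x"
  unfolding cvec_norm_L2_set[OF carrier_vec_dim_vec] by (rule L2_set_nonneg)

lemma cvec_norm_power2: "x \<in> carrier_vec n \<Longrightarrow> (cvec_norm x)\<^sup>2 = (\<Sum>i<n. (cmod (x $ i))\<^sup>2)"
  by (simp add: cvec_norm_L2_set L2_set_def sum_nonneg)

lemma cscalar_prod_self: "x \<bullet>c x = complex_of_real ((cvec_norm x)\<^sup>2)"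
proof -
  have x: "x \<in> carrier_vec (dim_vec x)" by simp
  show ?thesis
    unfolding cvec_norm_power2[OF x] cscalar_prod_sum[OF x x]
    by (simp add: complex_norm_square[symmetric] del: of_real_power)
qed

lemma cvec_norm_eq_0_iff: "x \<in> carrier_vec n \<Longrightarrow> cvec_norm x = 0 \<longleftrightarrow> x = 0\<^sub>v n"
  by (auto simp: cvec_norm_L2_set L2_set_eq_0_iff)

lemma cvec_norm_smult: "cvec_norm (c \<cdot>\<^sub>v x) = cmod c * cvec_norm x"
proof -
  have x: "x \<in> carrier_vec (dim_vec x)" by simp
  have "cvec_norm (c \<cdot>\<^sub>v x) = L2_set (\<lambda>i. cmod c * cmod (x $ i)) {..<dim_vec x}"
    using x by (subst cvec_norm_L2_set[of _ "dim_vec x"]) (auto simp: norm_mult intro!: L2_set_cong)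
  then show ?thesis
    by (simp add: cvec_norm_L2_set[OF x] L2_set_right_distrib)
qed

lemma cmod_cscalar_prod_le:
  assumes x: "x \<in> carrier_vec n" and y: "y \<in> carrier_vec n"
  shows "cmod (x \<bullet>c y) \<le> cvec_norm x * cvec_norm y"
proof -
  have "cmod (x \<bullet>c y) \<le> (\<Sum>i<n. cmod (x $ i) * cmod (y $ i))"
    unfolding cscalar_prod_sum[OF assms] by (rule order.trans[OF norm_sum]) (simp add: norm_mult)
  also have "\<dots> \<le> cvec_norm x * cvec_norm y"
    using L2_set_mult_ineq[of "\<lambda>i. cmod (x $ i)" "\<lambda>i. cmod (y $ i)" "{..<n}"]
    by (simp add: cvec_norm_L2_set[OF x] cvec_norm_L2_set[OF y])
  finally show ?thesis .
qed

text \<open>Cauchy-Schwarz on each row gives a crude constant. Any finite one will do: it shows that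
  the supremum in \<open>op_norm\<close> is taken over a bounded set.\<close>

lemma mult_mat_vec_bounded:
  fixes A :: "complex mat"
  assumes "A \<in> carrier_mat m n"
  obtains K where "0 \<le> K" "\<And>x. x \<in> carrier_vec n \<Longrightarrow> cvec_norm (A *\<^sub>v x) \<le> K * cvec_norm x"
proof
  show "0 \<le> (\<Sum>i<m. cvec_norm (row A i))" by (simp add: sum_nonneg)
  fix x :: "complex vec" assume x: "x \<in> carrier_vec n"
  have "cvec_norm (A *\<^sub>v x) = L2_set (\<lambda>i. cmod ((A *\<^sub>v x) $ i)) {..<m}"
    using assms x by (intro cvec_norm_L2_set) auto
  also have "\<dots> \<le> (\<Sum>i<m. cmod ((A *\<^sub>v x) $ i))"
    by (intro L2_set_le_sum) auto
  also have "\<dots> \<le> (\<Sum>i<m. cvec_norm (row A i) * cvec_norm x)"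
  proof (intro sum_mono)
    fix i assume "i \<in> {..<m}"
    then have i: "i < m" by simp
    \<comment> \<open>Matrix-vector products use the bilinear product, Cauchy-Schwarz the
      sesquilinear one. Conjugating \<open>x\<close> passes between them without changing its
      norm.\<close>
    have "cvec_norm (conjugate x) = cvec_norm x"
      unfolding cvec_norm_L2_set[OF x] cvec_norm_L2_set[OF carrier_vec_conjugate[OF x]]
      using x by (intro L2_set_cong) auto
    moreover have "(A *\<^sub>v x) $ i = row A i \<bullet>c conjugate x"
      using assms x i by simp
    ultimately show "cmod ((A *\<^sub>v x) $ i) \<le> cvec_norm (row A i) * cvec_norm x"
      using cmod_cscalar_prod_le[of "row A i" n "conjugate x"] assms x i by auto
  qed
  finally show "cvec_norm (A *\<^sub>v x) \<le> (\<Sum>i<m. cvec_norm (row A i)) * cvec_norm x"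
    by (simp add: sum_distrib_right)
qed

lemma op_norm_bound:
  assumes A: "A \<in> carrier_mat m n" and x: "x \<in> carrier_vec n"
  shows "cvec_norm (A *\<^sub>v x) \<le> op_norm A * cvec_norm x"
proof -
  obtain K where K: "0 \<le> K" "\<And>x. x \<in> carrier_vec n \<Longrightarrow> cvec_norm (A *\<^sub>v x) \<le> K * cvec_norm x"
    using mult_mat_vec_bounded[OF A] by blast
  let ?B = "{x \<in> carrier_vec (dim_col A). cvec_norm x \<le> 1}"
  have bdd: "bdd_above ((\<lambda>x. cvec_norm (A *\<^sub>v x)) ` ?B)"
  proof (rule bdd_aboveI2)
    fix x assume "x \<in> ?B"
    then have "cvec_norm (A *\<^sub>v x) \<le> K * cvec_norm x" "cvec_norm x \<le> 1" using A K by auto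
    with K(1) show "cvec_norm (A *\<^sub>v x) \<le> K"
      by (meson mult_left_le order_trans)
  qed
  show ?thesis
  proof (cases "cvec_norm x = 0")
    case True
    with K(2)[OF x] show ?thesis by simp
  next
    case False
    let ?c = "complex_of_real (1 / cvec_norm x)"
    have "?c \<cdot>\<^sub>v x \<in> ?B"
      using A x False by (simp add: cvec_norm_smult norm_divide)
    then have "cvec_norm (A *\<^sub>v (?c \<cdot>\<^sub>v x)) \<le> op_norm A"
      unfolding op_norm_def by (rule cSUP_upper[OF _ bdd])
    moreover have "cvec_norm (A *\<^sub>v (?c \<cdot>\<^sub>v x)) = cvec_norm (A *\<^sub>v x) / cvec_norm x"
      using A x by (simp add: mult_mat_vec cvec_norm_smult norm_divide)
    moreover have "0 < cvec_norm x" using False cvec_norm_nonneg[of x] by linarith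
    ultimately show ?thesis
      by (simp add: pos_divide_le_eq)
  qed
qed

lemma op_norm_leI:
  assumes "A \<in> carrier_mat m n" and "0 \<le> K"
    and "\<And>x. x \<in> carrier_vec n \<Longrightarrow> cvec_norm (A *\<^sub>v x) \<le> K * cvec_norm x"
  shows "op_norm A \<le> K"
  unfolding op_norm_def
proof (rule cSUP_least)
  have "0\<^sub>v n \<in> {x \<in> carrier_vec (dim_col A). cvec_norm x \<le> 1}"
    using assms(1) cvec_norm_eq_0_iff[of "0\<^sub>v n" n] by simp
  then show "{x \<in> carrier_vec (dim_col A). cvec_norm x \<le> 1} \<noteq> {}" by blast
  fix x assume "x \<in> {x \<in> carrier_vec (dim_col A). cvec_norm x \<le> 1}"
  then have "cvec_norm (A *\<^sub>v x) \<le> K * cvec_norm x" "cvec_norm x \<le> 1" using assms by auto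
  with assms(2) show "cvec_norm (A *\<^sub>v x) \<le> K"
    by (meson mult_left_le order_trans)
qed

text \<open>Uniform bounds on vectors are easier to combine than suprema; all later uses of
  powerboundedness go through this form.\<close>

lemma powerbounded_iff:
  assumes T: "T \<in> carrier_mat d d"
  shows "powerbounded T \<longleftrightarrow>
    (\<exists>M. \<forall>n\<ge>1. \<forall>x \<in> carrier_vec d. cvec_norm (T ^\<^sub>m n *\<^sub>v x) \<le> M * cvec_norm x)"
    (is "_ \<longleftrightarrow> ?R")
proof
  assume "powerbounded T"
  then obtain M where M: "\<forall>n\<ge>1. op_norm (T ^\<^sub>m n) < M" unfolding powerbounded_def by auto
  show ?R
  proof (intro exI allI impI ballI)
    fix n :: nat and x :: "complex vec" assume n: "1 \<le> n" and x: "x \<in> carrier_vec d"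
    have "cvec_norm (T ^\<^sub>m n *\<^sub>v x) \<le> op_norm (T ^\<^sub>m n) * cvec_norm x"
      using T x by (intro op_norm_bound) auto
    also have "\<dots> \<le> M * cvec_norm x"
      using M n by (intro mult_right_mono) auto
    finally show "cvec_norm (T ^\<^sub>m n *\<^sub>v x) \<le> M * cvec_norm x" .
  qed
next
  assume ?R
  then obtain M where M: "\<And>n x. 1 \<le> n \<Longrightarrow> x \<in> carrier_vec d \<Longrightarrow> cvec_norm (T ^\<^sub>m n *\<^sub>v x) \<le> M * cvec_norm x"
    by auto
  \<comment> \<open>The definition asks for a strict and positive bound, while in dimension 0 the
    given \<open>M\<close> may be negative.\<close>
  have "op_norm (T ^\<^sub>m n) < \<bar>M\<bar> + 1" if "1 \<le> n" for n
  proof -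
    have "cvec_norm (T ^\<^sub>m n *\<^sub>v x) \<le> \<bar>M\<bar> * cvec_norm x" if "x \<in> carrier_vec d" for x
      using M[OF \<open>1 \<le> n\<close> that] mult_right_mono[of M "\<bar>M\<bar>" "cvec_norm x"]
      by (meson abs_ge_self cvec_norm_nonneg order_trans)
    then have "op_norm (T ^\<^sub>m n) \<le> \<bar>M\<bar>"
      using T by (intro op_norm_leI[where n = d and m = d]) auto
    then show ?thesis by simp
  qed
  then show "powerbounded T" unfolding powerbounded_def by (intro exI[of _ "\<bar>M\<bar> + 1"]) auto
qed

section \<open>The spectral theorem for positive semidefinite matrices\<close>

lemma index_adjoint_mult:
  fixes A B :: "complex mat"
  assumes "A \<in> carrier_mat m n" "B \<in> carrier_mat m p" "i < n" "j < p"
  shows "(mat_adjoint A * B) $$ (i, j) = col B j \<bullet>c col A i"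
  using assms by (auto simp: scalar_prod_def intro!: sum.cong)

definition unitary_mat :: "nat \<Rightarrow> complex mat \<Rightarrow> bool" where
  "unitary_mat n U \<longleftrightarrow> U \<in> carrier_mat n n \<and> mat_adjoint U * U = 1\<^sub>m n"

lemma unitary_matD:
  assumes "unitary_mat n U"
  shows "U \<in> carrier_mat n n" "mat_adjoint U * U = 1\<^sub>m n" "U * mat_adjoint U = 1\<^sub>m n"
  using assms mat_mult_left_right_inverse[of "mat_adjoint U" n U] by (auto simp: unitary_mat_def)

lemma unitary_mat_mult:
  assumes "unitary_mat n U" "unitary_mat n V"
  shows "unitary_mat n (U * V)"
proof -
  note U = unitary_matD[OF assms(1)] and V = unitary_matD[OF assms(2)]
  have "mat_adjoint (U * V) * (U * V) = mat_adjoint V * (mat_adjoint U * U) * V"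
    using U(1) V(1)
    by (simp add: mat_adjoint_mult[of _ n n _ n] assoc_mult_mat[of _ n n _ n _ n] mult_carrier_mat[of _ n n _ n])
  then show ?thesis
    using U V by (simp add: unitary_mat_def)
qed

lemma cvec_norm_unitary_mult:
  assumes U: "unitary_mat n U" and x: "x \<in> carrier_vec n"
  shows "cvec_norm (U *\<^sub>v x) = cvec_norm x"
proof -
  have "(U *\<^sub>v x) \<bullet>c (U *\<^sub>v x) = x \<bullet>c x"
    using unitary_matD[OF U] x by (subst cscalar_prod_adjoint'[of _ n n _ n]) auto
  then show ?thesis by (simp add: cvec_norm_def)
qed

text \<open>Complete \<open>v\<close> to a basis, orthogonalize and normalize. Gram-Schmidt keeps
  its first vector, so normalization only rescales \<open>v\<close>.\<close>

lemma unitary_mat_first_column: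
  fixes v :: "complex vec"
  assumes v: "v \<in> carrier_vec n" "v \<noteq> 0\<^sub>v n"
  obtains W c where "unitary_mat n W" "col W 0 = c \<cdot>\<^sub>v v"
proof -
  have n: "n \<noteq> 0" using v by (metis carrier_vecD eq_vecI index_zero_vec(2) less_nat_zero_code)
  define ws where "ws = gram_schmidt n (basis_completion v)"
  interpret cof_vec_space n "TYPE(complex)" .
  note b = basis_completion[OF v]
  from gram_schmidt_result[OF b(2) b(4) b(5) refl, folded ws_def]
  have ws: "set ws \<subseteq> carrier_vec n" "corthogonal ws" "length ws = n" 
    by (auto simp: b(6))
  have "basis_completion v = v # tl (basis_completion v)"
    using b(6,7) n by (cases "basis_completion v") auto
  then have "hd ws = v" 
    unfolding ws_def using gram_schmidt_hd[OF v(1)] by metis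
  then have hd: "ws ! 0 = v" using ws(3) n by (cases ws) auto
  define W where "W = mat_of_cols n (map (\<lambda>w. complex_of_real (1 / cvec_norm w) \<cdot>\<^sub>v w) ws)"
  have W: "W \<in> carrier_mat n n"
    unfolding W_def using ws(3) by (auto intro!: carrier_matI)
  have col: "col W i = complex_of_real (1 / cvec_norm (ws ! i)) \<cdot>\<^sub>v ws ! i" "ws ! i \<in> carrier_vec n" if "i < n" for i
    unfolding W_def using ws that
    by (auto simp: subset_iff intro!: col_mat_of_cols[THEN trans] nth_mem)
  have "mat_adjoint W * W = 1\<^sub>m n"
  proof (rule eq_matI)
    fix i j assume "i < dim_row (1\<^sub>m n :: complex mat)" "j < dim_col (1\<^sub>m n :: complex mat)"
    then have ij: "i < n" "j < n" by auto
    have "(mat_adjoint W * W) $$ (i, j) = 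
        complex_of_real (1 / cvec_norm (ws ! j)) * (complex_of_real (1 / cvec_norm (ws ! i)) * (ws ! j \<bullet>c ws ! i))"
      unfolding index_adjoint_mult[OF W W ij] col(1)[OF ij(1)] col(1)[OF ij(2)] conjugate_smult_vec
      using col(2)[OF ij(1)] col(2)[OF ij(2)] by simp
    also have "\<dots> = (1\<^sub>m n :: complex mat) $$ (i, j)"
    proof (cases "i = j")
      case True
      have "ws ! i \<bullet>c ws ! i \<noteq> 0" 
        using corthogonalD[OF ws(2), of i i] ij ws(3) by simp
      with True ij show ?thesis
        by (simp add: cscalar_prod_self power2_eq_square)
    next
      case False
      then have "ws ! j \<bullet>c ws ! i = 0" 
        using corthogonalD[OF ws(2), of j i] ij ws(3) by simp
      with False ij show ?thesis by simp
    qed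
    finally show "(mat_adjoint W * W) $$ (i, j) = (1\<^sub>m n :: complex mat) $$ (i, j)" .
  qed (use W in auto)
  then have "unitary_mat n W" using W by (simp add: unitary_mat_def)
  moreover have "col W 0 = complex_of_real (1 / cvec_norm v) \<cdot>\<^sub>v v"
    using col(1)[of 0] n hd by simp
  ultimately show thesis by (rule that)
qed

lemma four_block_mat_diag:
  "four_block_mat (mat_diag m f) (0\<^sub>m m n) (0\<^sub>m n m) (mat_diag n g) = 
    mat_diag (m + n) (\<lambda>i. if i < m then f i else g (i - m))"
  by (rule eq_matI) (auto simp: mat_diag_def)

text \<open>Deflation: a unitary matrix whose first column is an eigenvector splits off a 1 by 1
  block, and the induction hypothesis diagonalizes the rest. The diagonal follows the order of
  \<open>es\<close>, which the caller may choose.\<close>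

theorem hermitian_spectral:
  fixes A :: "complex mat"
  assumes "A \<in> carrier_mat n n" "mat_adjoint A = A" "char_poly A = (\<Prod>e\<leftarrow>es. [:- e, 1:])"
  shows "\<exists>U. unitary_mat n U \<and> mat_adjoint U * A * U = mat_diag n (\<lambda>i. es ! i)"
  using assms
proof (induction es arbitrary: n A)
  case Nil
  then have "n = 0" using degree_monic_char_poly[of A n] by simp
  moreover from this have "unitary_mat 0 (1\<^sub>m 0)" by (simp add: unitary_mat_def)
  ultimately show ?case using Nil(1) by (intro exI[of _ "1\<^sub>m 0"]) (auto simp: mat_diag_def intro!: eq_matI)
next
  case (Cons e es)
  note A = Cons.prems(1)
  have "degree (char_poly A) = Suc (length es)"
    unfolding Cons.prems(3) using degree_linear_factors[of uminus "e # es"] by simp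
  then obtain m where n: "n = Suc m" using degree_monic_char_poly[OF A] by simp
  have "eigenvalue A e"
    unfolding eigenvalue_root_char_poly[OF A] Cons.prems(3) by simp
  then obtain v where v: "v \<in> carrier_vec n" "v \<noteq> 0\<^sub>v n" "A *\<^sub>v v = e \<cdot>\<^sub>v v"
    using A unfolding eigenvalue_def eigenvector_def by auto
  obtain W c where unW: "unitary_mat n W" and colW: "col W 0 = c \<cdot>\<^sub>v v"
    using unitary_mat_first_column[OF v(1,2)] .
  note W = unitary_matD[OF unW]
  define A' where "A' = mat_adjoint W * A * W"
  have A': "A' \<in> carrier_mat n n" unfolding A'_def using W A by auto
  have herm: "mat_adjoint A' = A'"
    unfolding A'_def using W(1) A Cons.prems(2)
    by (simp add: mat_adjoint_mult[of _ n n _ n] assoc_mult_mat[of _ n n _ n _ n])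
  \<comment> \<open>The first column of \<open>W\<close> is an eigenvector for \<open>e\<close>, and
    the adjoint of \<open>W\<close> maps it to the first unit vector.\<close>
  have "col A' 0 = mat_adjoint W *\<^sub>v (A *\<^sub>v col W 0)"
    unfolding A'_def using W(1) A n by (simp add: assoc_mult_mat[of _ n n _ n _ n] col_mult2[of _ n n _ n] del: col_mult)
  also have "\<dots> = e \<cdot>\<^sub>v (mat_adjoint W *\<^sub>v col W 0)"
    unfolding colW using W(1) A v by (simp add: mult_mat_vec[of _ n n] smult_smult_assoc mult.commute)
  also have "mat_adjoint W *\<^sub>v col W 0 = col (mat_adjoint W * W) 0"
    using W(1) n by (simp add: col_mult2[of _ n n _ n] del: col_mult)
  finally have col0: "col A' 0 = e \<cdot>\<^sub>v unit_vec n 0"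
    unfolding W(2) using n by simp
  have A'0: "A' $$ (i, 0) = (if i = 0 then e else 0)" if "i < n" for i
  proof -
    have "A' $$ (i, 0) = col A' 0 $ i" using that A' n by simp
    then show ?thesis unfolding col0 using that by (simp add: n)
  qed
  \<comment> \<open>Hermitian symmetry carries the zeros of the first column over to the first
    row.\<close>
  have A'0': "A' $$ (0, i) = 0" if "i < n" "i \<noteq> 0" for i
  proof -
    have "A' $$ (0, i) = mat_adjoint A' $$ (0, i)" by (simp add: herm)
    also have "\<dots> = 0" using that A' n by (simp add: A'0)
    finally show ?thesis .
  qed
  define A3 where "A3 = mat m m (\<lambda>(i, j). A' $$ (Suc i, Suc j))"
  define E where "E = mat_diag 1 (\<lambda>_. e)"
  have carr: "A3 \<in> carrier_mat m m" "E \<in> carrier_mat 1 1" by (auto simp: A3_def E_def)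
  have block: "A' = four_block_mat E (0\<^sub>m 1 m) (0\<^sub>m m 1) A3"
    using A' by (intro eq_matI) (auto simp: E_def A3_def mat_diag_def n A'0 A'0')
  have "mat_adjoint A3 = A3"
  proof (rule eq_matI)
    fix i j assume "i < dim_row A3" "j < dim_col A3"
    then have ij: "i < m" "j < m" by (auto simp: A3_def)
    have "A' $$ (Suc i, Suc j) = mat_adjoint A' $$ (Suc i, Suc j)" by (simp add: herm)
    then show "mat_adjoint A3 $$ (i, j) = A3 $$ (i, j)" using ij A' n by (simp add: A3_def)
  qed (auto simp: A3_def)
  moreover have "char_poly A3 = (\<Prod>e\<leftarrow>es. [:- e, 1:])"
  proof -
    \<comment> \<open>Similarity preserves the characteristic polynomial; cancelling the factor of
      the split-off block leaves that of \<open>A3\<close>.\<close>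
    have "similar_mat_wit A' A (mat_adjoint W) W"
      using W A A' by (intro similar_mat_witI[of _ _ n]) (auto simp: A'_def)
    then have "char_poly A' = [:- e, 1:] * (\<Prod>e\<leftarrow>es. [:- e, 1:])"
      using char_poly_similar[of A' A] Cons.prems(3) unfolding similar_mat_def by auto
    moreover have "char_poly A' = char_poly E * char_poly A3"
      unfolding block using carr by (intro char_poly_four_block_zeros_col) auto
    moreover have "char_poly E = [:- e, 1:]"
      by (simp add: E_def mat_diag_def char_poly_defs det_def sign_def)
    ultimately show ?thesis
      by (metis mult_cancel_left pCons_eq_0_iff zero_neq_one)
  qed
  ultimately obtain V where unV: "unitary_mat m V" and V: "mat_adjoint V * A3 * V = mat_diag m (\<lambda>i. es ! i)"
    using Cons.IH[of A3 m] carr(1) by auto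
  note V' = unitary_matD[OF unV]
  define B where "B = four_block_mat (1\<^sub>m 1) (0\<^sub>m 1 m) (0\<^sub>m m 1) V"
  have B: "B \<in> carrier_mat n n" unfolding B_def n using V'(1) by auto
  have adjB: "mat_adjoint B = four_block_mat (1\<^sub>m 1) (0\<^sub>m 1 m) (0\<^sub>m m 1) (mat_adjoint V)"
    using V'(1) by (intro eq_matI) (auto simp: B_def)
  have "mat_adjoint B * B = 1\<^sub>m n"
    unfolding adjB unfolding B_def n using V'
    by (subst mult_four_block_mat[of _ 1 1 _ m _ m _ _ 1 _ m]) auto
  then have unB: "unitary_mat n B" using B by (simp add: unitary_mat_def)
  have "mat_adjoint B * A' * B = four_block_mat E (0\<^sub>m 1 m) (0\<^sub>m m 1) (mat_adjoint V * A3 * V)"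
    unfolding adjB unfolding B_def block using V'(1) carr
    by (simp add: mult_four_block_mat[of _ 1 1 _ m _ m _ _ 1 _ m] mult_carrier_mat[of _ m m _ m])
  also have "\<dots> = mat_diag n (\<lambda>i. (e # es) ! i)"
    unfolding V E_def four_block_mat_diag n 
    by (auto simp: mat_diag_def nth_Cons' intro!: eq_matI)
  finally have diag: "mat_adjoint B * A' * B = mat_diag n (\<lambda>i. (e # es) ! i)" .
  have "mat_adjoint (W * B) * A * (W * B) = (mat_adjoint B * (mat_adjoint W * A)) * (W * B)"
    using W(1) A B by (simp add: mat_adjoint_mult[of _ n n _ n] assoc_mult_mat[of _ n n _ n _ n])
  also have "\<dots> = (mat_adjoint B * (mat_adjoint W * A) * W) * B"
    using W(1) A B by (intro assoc_mult_mat[of _ n n _ n _ n, symmetric]) auto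
  also have "\<dots> = mat_adjoint B * A' * B"
    unfolding A'_def using W(1) A B by (subst assoc_mult_mat[of _ n n _ n _ n]) (auto simp: mult_carrier_mat)
  finally have "mat_adjoint (W * B) * A * (W * B) = mat_adjoint B * A' * B" .
  with diag unitary_mat_mult[OF unW unB] show ?case by auto
qed

text \<open>Cancels outer inverse pairs by associativity. The left and right pairs are independent,
  so this serves unitary conjugation as well as congruence by a non-unitary
  \<open>S\<close>.\<close>

lemma mat_inverse_mult:
  fixes U :: "complex mat"
  assumes "A \<in> carrier_mat n n" "U \<in> carrier_mat n n" "U' \<in> carrier_mat n n" "V \<in> carrier_mat n n" "V' \<in> carrier_mat n n"
    and "U * U' = 1\<^sub>m n" "V' * V = 1\<^sub>m n"
  shows "U * (U' * A * V') * V = A"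
proof -
  have "U * (U' * A * V') * V = (U * U') * A * (V' * V)"
    using assms(1-5) by (simp add: assoc_mult_mat[of _ n n _ n _ n] mult_carrier_mat[of _ n n _ n])
  then show ?thesis using assms by simp
qed

text \<open>Polarization: the form is real at \<open>x + c y\<close> for every scalar
  \<open>c\<close>. Taking \<open>c = 1\<close> relates the imaginary parts of the two mixed terms,
  and \<open>c = \<i>\<close> their real parts.\<close>

lemma pos_semidef_hermitian:
  assumes "pos_semidef d A"
  shows "mat_adjoint A = A"
proof (rule mat_eq_by_form[of _ d d])
  have A: "A \<in> carrier_mat d d" and pos: "\<And>x. x \<in> carrier_vec d \<Longrightarrow> 0 \<le> (A *\<^sub>v x) \<bullet>c x"
    using assms by (auto simp: pos_semidef_def)
  show "A \<in> carrier_mat d d" "mat_adjoint A \<in> carrier_mat d d" using A by auto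
  fix x y :: "complex vec" assume x: "x \<in> carrier_vec d" and y: "y \<in> carrier_vec d"
  let ?f = "\<lambda>x y. (A *\<^sub>v x) \<bullet>c y"
  have real: "Im (?f x x) = 0" if "x \<in> carrier_vec d" for x
    using pos[OF that] by (simp add: less_eq_complex_def)
  have expand: "?f (x + c \<cdot>\<^sub>v y) (x + c \<cdot>\<^sub>v y) = ?f x x + cnj c * ?f x y + c * ?f y x + c * cnj c * ?f y y" for c
    using A x y
    by (simp add: mult_add_distrib_mat_vec[of _ d d] mult_mat_vec[of _ d d] conjugate_add_vec[of _ d]
          conjugate_smult_vec add_scalar_prod_distrib[of _ d] scalar_prod_add_distrib[of _ d] algebra_simps)
  have "Im (?f x y) + Im (?f y x) = 0"
    using real[of "x + 1 \<cdot>\<^sub>v y"] real[OF x] real[OF y] x y unfolding expand by simp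
  moreover have "Re (?f y x) - Re (?f x y) = 0"
    using real[of "x + \<i> \<cdot>\<^sub>v y"] real[OF x] real[OF y] x y unfolding expand by simp
  ultimately have "?f x y = cnj (?f y x)"
    by (simp add: complex_eq_iff)
  also have "\<dots> = x \<bullet>c (A *\<^sub>v y)"
    using A x y conjugate_sprod_vec[of "A *\<^sub>v y" d "conjugate x"] 
      comm_scalar_prod[of "conjugate (A *\<^sub>v y)" d x] by simp
  also have "\<dots> = (mat_adjoint A *\<^sub>v x) \<bullet>c y"
    using cscalar_prod_adjoint[of "mat_adjoint A" d d x y] A x y by simp
  finally show "(mat_adjoint A *\<^sub>v x) \<bullet>c y = ?f x y" ..
qed

lemma prod_list_linear_factors_mset:
  "(\<Prod>a\<leftarrow>as. [:- a, 1:]) = prod_mset (image_mset (\<lambda>a. [:- a, 1:]) (mset as))"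
  by (induction as) auto

lemma proots_linear_factors: "proots (\<Prod>a\<leftarrow>as. [:- a :: complex, 1:]) = mset as"
proof (induction as)
  case (Cons a as)
  have "(\<Prod>a\<leftarrow>as. [:- a, 1:]) \<noteq> 0" by (auto simp: prod_list_zero_iff)
  then have "proots ([:- a, 1:] * (\<Prod>a\<leftarrow>as. [:- a, 1:])) = proots [:- a, 1:] + mset as"
    unfolding Cons[symmetric] by (intro proots_mult) auto
  then show ?case by simp
qed simp

text \<open>The spectral theorem accepts the eigenvalues in any order. Listing the nonzero ones
  first makes the first \<open>r\<close> columns of \<open>U\<close> span the range and the others
  the kernel, which fixes the index ranges used from here on.\<close>

lemma pos_semidef_spectral:
  assumes psd: "pos_semidef d A"
  obtains U :: "complex mat" and t :: "nat \<Rightarrow> real" and r :: nat where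
    "unitary_mat d U" "A = U * mat_diag d (\<lambda>i. complex_of_real (t i)) * mat_adjoint U" "r \<le> d"
    "\<And>i. i < r \<Longrightarrow> 0 < t i" "\<And>i. r \<le> i \<Longrightarrow> i < d \<Longrightarrow> t i = 0"
    "nonzero_eigenvalues A = mset (map (\<lambda>i. complex_of_real (t i)) [0..<r])"
proof -
  have A: "A \<in> carrier_mat d d" and pos: "\<And>x. x \<in> carrier_vec d \<Longrightarrow> 0 \<le> (A *\<^sub>v x) \<bullet>c x"
    using psd by (auto simp: pos_semidef_def)
  obtain as where as: "char_poly A = (\<Prod>a\<leftarrow>as. [:- a, 1:])" "length as = d"
    using char_poly_factorized[OF A] by auto
  define nz where "nz = filter (\<lambda>a. a \<noteq> 0) as"
  define es where "es = nz @ filter (\<lambda>a. a = 0) as"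
  have mset_es: "mset es = mset as"
    unfolding es_def nz_def by (induction as) auto
  then have len: "length es = d" using as(2) mset_eq_length by blast
  have "char_poly A = (\<Prod>a\<leftarrow>es. [:- a, 1:])"
    unfolding as(1) prod_list_linear_factors_mset mset_es ..
  from hermitian_spectral[OF A pos_semidef_hermitian[OF psd] this]
  obtain U where unU: "unitary_mat d U" and diag: "mat_adjoint U * A * U = mat_diag d (\<lambda>i. es ! i)"
    by auto
  note U = unitary_matD[OF unU]
  \<comment> \<open>A diagonal entry of the diagonalized matrix is the form of \<open>A\<close> at a
    column of \<open>U\<close>.\<close>
  have nonneg: "0 \<le> es ! i" if i: "i < d" for i
  proof -
    have "es ! i = (mat_adjoint U * A * U) $$ (i, i)"
      unfolding diag using i by (simp add: mat_diag_def)
    also have "\<dots> = (mat_adjoint U * (A * U)) $$ (i, i)"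
      using U(1) A by (subst assoc_mult_mat[of _ d d _ d _ d]) auto
    also have "\<dots> = (A *\<^sub>v col U i) \<bullet>c col U i"
      using i U(1) A by (subst index_adjoint_mult[of _ d d _ d]) (auto simp: col_mult2[of _ d d _ d] simp del: col_mult)
    finally show ?thesis using pos[of "col U i"] i U(1) by simp
  qed
  define t where "t = (\<lambda>i. Re (es ! i))"
  have es_t: "es ! i = complex_of_real (t i)" if "i < d" for i
    using nonneg[OF that] by (simp add: t_def complex_eq_iff less_eq_complex_def)
  show thesis
  proof (rule that[of U t "length nz"])
    have "A = U * (mat_adjoint U * A * U) * mat_adjoint U"
      using mat_inverse_mult[OF A U(1) _ _ U(1) U(3) U(3)] U(1) by simp
    also have "mat_adjoint U * A * U = mat_diag d (\<lambda>i. complex_of_real (t i))"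
      unfolding diag using es_t by (auto simp: mat_diag_def)
    finally show "A = U * mat_diag d (\<lambda>i. complex_of_real (t i)) * mat_adjoint U" .
    show le: "length nz \<le> d" unfolding nz_def as(2)[symmetric] by simp
    show "0 < t i" if "i < length nz" for i
    proof -
      have "es ! i \<in> set nz" using that by (simp add: es_def nth_append)
      then have "es ! i \<noteq> 0" by (simp add: nz_def)
      with nonneg[of i] es_t[of i] that le show ?thesis by (auto simp: less_eq_complex_def)
    qed
    show "t i = 0" if "length nz \<le> i" "i < d" for i
    proof -
      have "es ! i = filter (\<lambda>a. a = 0) as ! (i - length nz)"
        using that by (simp add: es_def nth_append)
      also have "\<dots> \<in> set (filter (\<lambda>a. a = 0) as)"
        using that len by (intro nth_mem) (auto simp: es_def)
      finally have "es ! i = 0" by simp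
      then show ?thesis by (simp add: t_def)
    qed
    have "nonzero_eigenvalues A = mset nz"
      unfolding nonzero_eigenvalues_def as(1) proots_linear_factors nz_def by simp
    also have "nz = map (\<lambda>i. complex_of_real (t i)) [0..<length nz]"
    proof (rule nth_equalityI)
      fix i assume "i < length nz"
      then show "nz ! i = map (\<lambda>i. complex_of_real (t i)) [0..<length nz] ! i"
        using es_t[of i] le by (simp add: es_def nth_append)
    qed simp
    finally show "nonzero_eigenvalues A = mset (map (\<lambda>i. complex_of_real (t i)) [0..<length nz])" .
  qed (rule unU)
qed

section \<open>Dimension of the kernel of a diagonalized matrix\<close>

lemma kernel_dim_zero_mat: "kernel.dim m (0\<^sub>m m m :: complex mat) = m"
proof -
  interpret vec_space "TYPE(complex)" m .
  have "mat_kernel (0\<^sub>m m m :: complex mat) = carrier V"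
    by (auto simp: mat_kernel_def)
  then have "V\<lparr>carrier := mat_kernel (0\<^sub>m m m :: complex mat)\<rparr> = V" by simp
  then show ?thesis using dim_is_n by simp
qed

text \<open>An invertible left factor leaves the kernel unchanged and an invertible right factor
  preserves its dimension. The diagonal matrix then splits into an injective block and a zero
  block.\<close>

lemma kernel_dim_mult_diag:
  fixes P Q :: "complex mat"
  assumes "P \<in> carrier_mat d d" "P' \<in> carrier_mat d d" "P' * P = 1\<^sub>m d"
    and "Q \<in> carrier_mat d d" "Q' \<in> carrier_mat d d" "Q * Q' = 1\<^sub>m d"
    and r: "r \<le> d" "\<And>i. i < r \<Longrightarrow> f i \<noteq> 0" "\<And>i. r \<le> i \<Longrightarrow> i < d \<Longrightarrow> f i = 0"
  shows "kernel.dim d (P * mat_diag d f * Q) = d - r"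
proof -
  define m where "m = d - r"
  have d: "d = r + m" using r(1) by (simp add: m_def)
  have block: "mat_diag d f = four_block_mat (mat_diag r f) (0\<^sub>m r m) (0\<^sub>m m r) (0\<^sub>m m m)"
    using r(3) by (intro eq_matI) (auto simp: mat_diag_def d)
  have "kernel.dim d (P * mat_diag d f * Q) = kernel.dim d (P * mat_diag d f)"
    using assms by (intro mat_kernel_dim_mult_eq_right[of _ d]) auto
  also have "mat_kernel (P * mat_diag d f) = mat_kernel (mat_diag d f)"
    using assms by (intro mat_kernel_mult_eq[of _ d d _ P']) auto
  also have "kernel.dim d (mat_diag d f) = kernel.dim r (mat_diag r f) + kernel.dim m (0\<^sub>m m m :: complex mat)"
    unfolding d by (rule kernel_four_block_0_mat[OF block[unfolded d]]) auto
  also have "kernel.dim r (mat_diag r f) = 0"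
    using r(2) by (intro kernel_upper_triangular(1)) (auto simp: mat_diag_def diag_mat_def)
  finally show ?thesis by (simp add: kernel_dim_zero_mat m_def)
qed

section \<open>Means of orbits\<close>

text \<open>The common abstraction of Cesaro means and Banach limits. \<open>M s a\<close> is a
  relation because a sequence may have no Cesaro mean. Boundedness enters \<open>shift\<close>
  because shifting changes the n-th average by \<open>(s n - s 0) / n\<close>. The exponent in
  \<open>geometric\<close> is \<open>Suc n\<close> since powers start at 1; its case
  \<open>z = 1\<close> normalizes the mean.\<close>

locale generalized_mean =
  fixes M :: "(nat \<Rightarrow> complex) \<Rightarrow> complex \<Rightarrow> bool"
  assumes add: "M s a \<Longrightarrow> M t b \<Longrightarrow> M (\<lambda>n. s n + t n) (a + b)"
    and scale: "M s a \<Longrightarrow> M (\<lambda>n. c * s n) (c * a)"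
    and unique: "M s a \<Longrightarrow> M s b \<Longrightarrow> a = b"
    and shift: "Bseq s \<Longrightarrow> M s a \<Longrightarrow> M (\<lambda>n. s (Suc n)) a"
    and nonneg: "M s a \<Longrightarrow> (\<And>n. 0 \<le> s n) \<Longrightarrow> 0 \<le> a"
    and geometric: "cmod z = 1 \<Longrightarrow> M (\<lambda>n. z ^ Suc n) (if z = 1 then 1 else 0)"
begin

lemma const: "M (\<lambda>n. c) c"
  using scale[OF geometric[of 1], of c] by simp

lemma sum: "finite I \<Longrightarrow> (\<And>i. i \<in> I \<Longrightarrow> M (s i) (a i)) \<Longrightarrow> M (\<lambda>n. \<Sum>i\<in>I. s i n) (\<Sum>i\<in>I. a i)"
  by (induction I rule: finite_induct) (auto intro: add const)

lemma lower_bound: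
  assumes "M s a" "\<And>n. c \<le> s n"
  shows "c \<le> a"
  using nonneg[OF add[OF assms(1) const[of "- c"]]] assms(2) by simp

end

text \<open>One notion for both kinds of asymptotic limit, stated through forms. As \<open>M\<close>
  is a relation, existence of the means is part of the assertion.\<close>

definition orbit_limit ::
  "((nat \<Rightarrow> complex) \<Rightarrow> complex \<Rightarrow> bool) \<Rightarrow> nat \<Rightarrow> complex mat \<Rightarrow> complex mat \<Rightarrow> bool" where
  "orbit_limit M d T A \<longleftrightarrow> A \<in> carrier_mat d d \<and>
     (\<forall>x \<in> carrier_vec d. \<forall>y \<in> carrier_vec d.
        M (\<lambda>n. (T ^\<^sub>m Suc n *\<^sub>v x) \<bullet>c (T ^\<^sub>m Suc n *\<^sub>v y)) ((A *\<^sub>v x) \<bullet>c y))"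

lemma pow_mat_Suc_left: "A \<in> carrier_mat n n \<Longrightarrow> A ^\<^sub>m Suc k = A * A ^\<^sub>m k"
proof (induction k)
  case (Suc k)
  have "A ^\<^sub>m Suc (Suc k) = A * A ^\<^sub>m k * A" using Suc by (simp del: pow_mat.simps add: pow_mat.simps(2)[of _ "Suc k"])
  then show ?case using Suc.prems by (simp add: assoc_mult_mat[of _ n n _ n _ n])
qed simp

lemma pow_mat_add:
  fixes A :: "complex mat"
  assumes "A \<in> carrier_mat n n" shows "A ^\<^sub>m (k + m) = A ^\<^sub>m k * A ^\<^sub>m m"
proof (induction m)
  case (Suc m)
  then show ?case using assms by (simp add: assoc_mult_mat[of _ n n _ n _ n])
qed (use assms in simp)

lemma mat_adjoint_pow:
  fixes A :: "complex mat"
  assumes A: "A \<in> carrier_mat n n" shows "mat_adjoint A ^\<^sub>m k = mat_adjoint (A ^\<^sub>m k)"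
proof (induction k)
  case (Suc k)
  have "mat_adjoint A ^\<^sub>m Suc k = mat_adjoint (A * A ^\<^sub>m k)"
    using A Suc by (simp add: mat_adjoint_mult[of _ n n _ n])
  then show ?case unfolding pow_mat_Suc_left[OF A] .
qed (use A in simp)

context generalized_mean
begin

text \<open>Unit vectors give the entries; conversely each form is a finite linear combination of
  the entries, and means are linear. This links the entrywise Cesaro definition to forms and later
  gives existence for Banach limits.\<close>

lemma orbit_limit_iff_entries:
  assumes T: "T \<in> carrier_mat d d" and A: "A \<in> carrier_mat d d"
  shows "orbit_limit M d T A \<longleftrightarrow> 
    (\<forall>p<d. \<forall>q<d. M (\<lambda>n. (mat_adjoint (T ^\<^sub>m Suc n) * T ^\<^sub>m Suc n) $$ (p, q)) (A $$ (p, q)))"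
    (is "_ \<longleftrightarrow> ?R")
proof -
  let ?G = "\<lambda>n. mat_adjoint (T ^\<^sub>m Suc n) * T ^\<^sub>m Suc n"
  have Tn: "T ^\<^sub>m n \<in> carrier_mat d d" for n using T by simp
  have G: "?G n \<in> carrier_mat d d" for n by (intro mult_carrier_mat[of _ d d] mat_adjoint_carrier Tn)
  have form: "(T ^\<^sub>m Suc n *\<^sub>v x) \<bullet>c (T ^\<^sub>m Suc n *\<^sub>v y) = (?G n *\<^sub>v x) \<bullet>c y"
    if "x \<in> carrier_vec d" "y \<in> carrier_vec d" for n x y
    using that by (intro cscalar_prod_adjoint'[OF Tn Tn])
  show ?thesis
  proof
    assume L: "orbit_limit M d T A"
    show ?R
    proof (intro allI impI)
      fix p q assume pq: "p < d" "q < d"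
      have "M (\<lambda>n. (T ^\<^sub>m Suc n *\<^sub>v unit_vec d q) \<bullet>c (T ^\<^sub>m Suc n *\<^sub>v unit_vec d p))
          ((A *\<^sub>v unit_vec d q) \<bullet>c unit_vec d p)"
        using L unfolding orbit_limit_def by (blast intro: unit_vec_carrier)
      then show "M (\<lambda>n. ?G n $$ (p, q)) (A $$ (p, q))"
        unfolding form[OF unit_vec_carrier unit_vec_carrier] 
          cscalar_prod_unit_vec[OF A pq] cscalar_prod_unit_vec[OF G pq] .
    qed
  next
    assume R: ?R
    have "M (\<lambda>n. (T ^\<^sub>m Suc n *\<^sub>v x) \<bullet>c (T ^\<^sub>m Suc n *\<^sub>v y)) ((A *\<^sub>v x) \<bullet>c y)"
      if x: "x \<in> carrier_vec d" and y: "y \<in> carrier_vec d" for x y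
    proof -
      have "M (\<lambda>n. \<Sum>p<d. \<Sum>q<d. (x $ q * cnj (y $ p)) * ?G n $$ (p, q)) 
              (\<Sum>p<d. \<Sum>q<d. (x $ q * cnj (y $ p)) * A $$ (p, q))"
        using R by (intro sum scale) auto
      then show ?thesis
        unfolding form[OF x y] mult_mat_vec_cscalar_prod[OF A x y] mult_mat_vec_cscalar_prod[OF G x y]
        by (simp only: ac_simps)
    qed
    then show "orbit_limit M d T A" using A by (auto simp: orbit_limit_def)
  qed
qed

end

lemma (in generalized_mean) orbit_limit_pos_semidef:
  assumes L: "orbit_limit M d T A"
  shows "pos_semidef d A"
  unfolding pos_semidef_def
proof (intro conjI ballI)
  show "A \<in> carrier_mat d d" using L by (simp add: orbit_limit_def)
  fix x :: "complex vec" assume "x \<in> carrier_vec d"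
  with L have "M (\<lambda>n. (T ^\<^sub>m Suc n *\<^sub>v x) \<bullet>c (T ^\<^sub>m Suc n *\<^sub>v x)) ((A *\<^sub>v x) \<bullet>c x)"
    by (simp add: orbit_limit_def)
  then show "0 \<le> (A *\<^sub>v x) \<bullet>c x" by (rule nonneg) (rule conjugate_square_ge_0_vec)
qed

text \<open>By Cauchy-Schwarz. Boundedness is what \<open>shift\<close> requires, and it puts the
  orbit sequences into the domain of a Banach limit.\<close>

lemma powerbounded_orbit_Bseq:
  assumes T: "T \<in> carrier_mat d d" "powerbounded T" and x: "x \<in> carrier_vec d" and y: "y \<in> carrier_vec d"
  shows "Bseq (\<lambda>n. (T ^\<^sub>m Suc n *\<^sub>v x) \<bullet>c (T ^\<^sub>m Suc n *\<^sub>v y))"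
proof -
  obtain K where K: "\<And>n x. 1 \<le> n \<Longrightarrow> x \<in> carrier_vec d \<Longrightarrow> cvec_norm (T ^\<^sub>m n *\<^sub>v x) \<le> K * cvec_norm x"
    using T by (auto simp: powerbounded_iff[OF T(1)])
  show ?thesis
  proof (rule BseqI')
    fix n
    have Tn: "T ^\<^sub>m Suc n \<in> carrier_mat d d" using T(1) by (rule pow_carrier_mat)
    have "cmod ((T ^\<^sub>m Suc n *\<^sub>v x) \<bullet>c (T ^\<^sub>m Suc n *\<^sub>v y)) 
        \<le> cvec_norm (T ^\<^sub>m Suc n *\<^sub>v x) * cvec_norm (T ^\<^sub>m Suc n *\<^sub>v y)"
      using x y by (intro cmod_cscalar_prod_le[of _ d] mult_mat_vec_carrier[OF Tn])
    also have "\<dots> \<le> (K * cvec_norm x) * (K * cvec_norm y)"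
      using K[of "Suc n"] x y by (intro mult_mono order.trans[OF cvec_norm_nonneg K[of "Suc n" x]]) auto
    finally show "cmod ((T ^\<^sub>m Suc n *\<^sub>v x) \<bullet>c (T ^\<^sub>m Suc n *\<^sub>v y)) \<le> (K * cvec_norm x) * (K * cvec_norm y)" .
  qed
qed

section \<open>Invariance of the limit form and the stable subspace\<close>

locale mean_orbit_limit = generalized_mean +
  fixes d :: nat and T A :: "complex mat"
  assumes T: "T \<in> carrier_mat d d" and bounded: "powerbounded T" and lim: "orbit_limit M d T A"
begin

lemma A: "A \<in> carrier_mat d d"
  using lim by (simp add: orbit_limit_def)

lemma Tn: "T ^\<^sub>m n \<in> carrier_mat d d"
  using T by simp

lemma mean_orbit:
  "x \<in> carrier_vec d \<Longrightarrow> y \<in> carrier_vec d \<Longrightarrow>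
    M (\<lambda>n. (T ^\<^sub>m Suc n *\<^sub>v x) \<bullet>c (T ^\<^sub>m Suc n *\<^sub>v y)) ((A *\<^sub>v x) \<bullet>c y)"
  using lim by (simp add: orbit_limit_def)

text \<open>Replacing \<open>x\<close> and \<open>y\<close> by their images under \<open>T\<close>
  shifts the orbit sequence by one, so both sides are means of the same shifted sequence.\<close>

lemma invariant_step:
  assumes x: "x \<in> carrier_vec d" and y: "y \<in> carrier_vec d"
  shows "(A *\<^sub>v (T *\<^sub>v x)) \<bullet>c (T *\<^sub>v y) = (A *\<^sub>v x) \<bullet>c y"
proof (rule unique)
  have Tx: "T *\<^sub>v x \<in> carrier_vec d" and Ty: "T *\<^sub>v y \<in> carrier_vec d" using T x y by auto
  have pow: "T ^\<^sub>m Suc n *\<^sub>v (T *\<^sub>v z) = T ^\<^sub>m Suc (Suc n) *\<^sub>v z" if "z \<in> carrier_vec d" for n z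
    unfolding pow_mat.simps(2)[of T "Suc n"] using T Tn[of "Suc n"] that
    by (intro assoc_mult_mat_vec[symmetric])
  show "M (\<lambda>n. (T ^\<^sub>m Suc (Suc n) *\<^sub>v x) \<bullet>c (T ^\<^sub>m Suc (Suc n) *\<^sub>v y)) ((A *\<^sub>v (T *\<^sub>v x)) \<bullet>c (T *\<^sub>v y))"
    using mean_orbit[OF Tx Ty] unfolding pow[OF x] pow[OF y] .
  show "M (\<lambda>n. (T ^\<^sub>m Suc (Suc n) *\<^sub>v x) \<bullet>c (T ^\<^sub>m Suc (Suc n) *\<^sub>v y)) ((A *\<^sub>v x) \<bullet>c y)"
    by (rule shift[OF powerbounded_orbit_Bseq[OF T bounded x y] mean_orbit[OF x y]])
qed

lemma invariant:
  assumes x: "x \<in> carrier_vec d" and y: "y \<in> carrier_vec d"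
  shows "(A *\<^sub>v (T ^\<^sub>m n *\<^sub>v x)) \<bullet>c (T ^\<^sub>m n *\<^sub>v y) = (A *\<^sub>v x) \<bullet>c y"
proof (induction n)
  case 0
  then show ?case using T x y by simp
next
  case (Suc n)
  have "T ^\<^sub>m Suc n *\<^sub>v z = T *\<^sub>v (T ^\<^sub>m n *\<^sub>v z)" if "z \<in> carrier_vec d" for z
    unfolding pow_mat_Suc_left[OF T] using T Tn that by (intro assoc_mult_mat_vec)
  then show ?case using invariant_step[of "T ^\<^sub>m n *\<^sub>v x" "T ^\<^sub>m n *\<^sub>v y"] Suc x y Tn[of n] by simp
qed

lemma power_bound:
  obtains K where "0 < K" "\<And>n x. x \<in> carrier_vec d \<Longrightarrow> cvec_norm (T ^\<^sub>m n *\<^sub>v x) \<le> K * cvec_norm x"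
proof -
  obtain K where K: "\<And>n x. 1 \<le> n \<Longrightarrow> x \<in> carrier_vec d \<Longrightarrow> cvec_norm (T ^\<^sub>m n *\<^sub>v x) \<le> K * cvec_norm x"
    using bounded by (auto simp: powerbounded_iff[OF T])
  \<comment> \<open>The maximum with 1 covers the identity at \<open>n = 0\<close> and makes the
    constant positive.\<close>
  have "cvec_norm (T ^\<^sub>m n *\<^sub>v x) \<le> max K 1 * cvec_norm x" if "x \<in> carrier_vec d" for n x
  proof (cases n)
    case 0
    then show ?thesis using that T mult_right_mono[of 1 "max K 1" "cvec_norm x"] by simp
  next
    case (Suc m)
    then have "1 \<le> n" by simp
    then have "cvec_norm (T ^\<^sub>m n *\<^sub>v x) \<le> K * cvec_norm x" by (rule K[OF _ that])
    also have "\<dots> \<le> max K 1 * cvec_norm x" by (intro mult_right_mono) auto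
    finally show ?thesis .
  qed
  then show thesis by (intro that[of "max K 1"]) auto
qed

text \<open>If the orbit of \<open>x\<close> tends to 0, invariance bounds the form of
  \<open>A\<close> at \<open>x\<close> and any \<open>y\<close> by a null sequence. If
  \<open>A\<close> annihilates \<open>x\<close>, the squared norms along the orbit have mean 0, so
  some of them are small, and powerboundedness keeps all later ones small.\<close>

lemma stable_subspace_eq_kernel: "stable_subspace T = mat_kernel A"
proof -
  obtain K where K: "0 < K" "\<And>n x. x \<in> carrier_vec d \<Longrightarrow> cvec_norm (T ^\<^sub>m n *\<^sub>v x) \<le> K * cvec_norm x"
    using power_bound by blast
  {
    fix x assume "x \<in> stable_subspace T"
    then have x: "x \<in> carrier_vec d" and x0: "(\<lambda>n. cvec_norm (T ^\<^sub>m n *\<^sub>v x)) \<longlonglongrightarrow> 0"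
      using T by (auto simp: stable_subspace_def)
    obtain K' where K': "0 \<le> K'" "\<And>x. x \<in> carrier_vec d \<Longrightarrow> cvec_norm (A *\<^sub>v x) \<le> K' * cvec_norm x"
      using mult_mat_vec_bounded[OF A] by blast
    have "(A *\<^sub>v x) \<bullet>c y = 0" if y: "y \<in> carrier_vec d" for y
    proof -
      have "cmod ((A *\<^sub>v x) \<bullet>c y) \<le> K' * cvec_norm (T ^\<^sub>m n *\<^sub>v x) * (K * cvec_norm y)" for n
      proof -
        have "cmod ((A *\<^sub>v x) \<bullet>c y) \<le> cvec_norm (A *\<^sub>v (T ^\<^sub>m n *\<^sub>v x)) * cvec_norm (T ^\<^sub>m n *\<^sub>v y)"
          unfolding invariant[OF x y, of n, symmetric] using A Tn[of n] x y
          by (intro cmod_cscalar_prod_le[of _ d]) auto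
        also have "\<dots> \<le> K' * cvec_norm (T ^\<^sub>m n *\<^sub>v x) * (K * cvec_norm y)"
          using K(2)[OF y] K'(2)[of "T ^\<^sub>m n *\<^sub>v x"] K'(1) Tn[of n] x by (intro mult_mono) auto
        finally show ?thesis .
      qed
      moreover have "(\<lambda>n. K' * cvec_norm (T ^\<^sub>m n *\<^sub>v x) * (K * cvec_norm y)) \<longlonglongrightarrow> K' * 0 * (K * cvec_norm y)"
        by (intro tendsto_intros x0)
      ultimately have "cmod ((A *\<^sub>v x) \<bullet>c y) \<le> K' * 0 * (K * cvec_norm y)"
        by (intro LIMSEQ_le_const) auto
      then show ?thesis by simp
    qed
    from this[of "A *\<^sub>v x"] have "A *\<^sub>v x = 0\<^sub>v d"
      using A x conjugate_square_eq_0_vec[of "A *\<^sub>v x" d] by auto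
    then have "x \<in> mat_kernel A" by (intro mat_kernelI[OF A x])
  }
  moreover {
    fix x assume "x \<in> mat_kernel A"
    then have x: "x \<in> carrier_vec d" and Ax: "A *\<^sub>v x = 0\<^sub>v d" using mat_kernelD[OF A] by auto
    \<comment> \<open>Otherwise all squared norms are at least \<open>e\<^sup>2\<close>, hence so is
      their mean, which is the form of \<open>A\<close> at \<open>x\<close> and vanishes.\<close>
    have small: "\<exists>n. cvec_norm (T ^\<^sub>m n *\<^sub>v x) < e" if "0 < e" for e
    proof (rule ccontr)
      assume "\<not> ?thesis"
      then have "e\<^sup>2 \<le> (cvec_norm (T ^\<^sub>m n *\<^sub>v x))\<^sup>2" for n
        using that by (intro power_mono) (auto simp: not_less)
      then have "complex_of_real (e\<^sup>2) \<le> (T ^\<^sub>m Suc n *\<^sub>v x) \<bullet>c (T ^\<^sub>m Suc n *\<^sub>v x)" for n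
        unfolding cscalar_prod_self by (simp add: less_eq_complex_def del: of_real_power pow_mat.simps)
      then have "complex_of_real (e\<^sup>2) \<le> (A *\<^sub>v x) \<bullet>c x"
        by (intro lower_bound[OF mean_orbit[OF x x]])
      also have "(A *\<^sub>v x) \<bullet>c x = 0" unfolding Ax using x by simp
      finally show False using that by (simp add: less_eq_complex_def del: of_real_power)
    qed
    have "(\<lambda>n. cvec_norm (T ^\<^sub>m n *\<^sub>v x)) \<longlonglongrightarrow> 0"
    proof (rule LIMSEQ_I)
      fix e :: real assume e: "0 < e"
      \<comment> \<open>Powers of \<open>T\<close> enlarge norms by a factor of at most
        \<open>K\<close>, which the threshold \<open>e / K\<close> absorbs.\<close>
      obtain n where n: "cvec_norm (T ^\<^sub>m n *\<^sub>v x) < e / K" using small[of "e / K"] e K(1) by auto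
      have "norm (cvec_norm (T ^\<^sub>m m *\<^sub>v x) - 0) < e" if "n \<le> m" for m
      proof -
        have "T ^\<^sub>m m *\<^sub>v x = T ^\<^sub>m (m - n) *\<^sub>v (T ^\<^sub>m n *\<^sub>v x)"
          using pow_mat_add[OF T, of "m - n" n] that x Tn by (metis assoc_mult_mat_vec le_add_diff_inverse2)
        then have "cvec_norm (T ^\<^sub>m m *\<^sub>v x) \<le> K * cvec_norm (T ^\<^sub>m n *\<^sub>v x)"
          using K(2)[of "T ^\<^sub>m n *\<^sub>v x"] x Tn[of n] by simp
        also have "\<dots> < e" using n K(1) by (simp add: pos_less_divide_eq mult.commute)
        finally show ?thesis by simp
      qed
      then show "\<exists>n. \<forall>m\<ge>n. norm (cvec_norm (T ^\<^sub>m m *\<^sub>v x) - 0) < e" by blast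
    qed
    then have "x \<in> stable_subspace T" using x T by (simp add: stable_subspace_def)
  }
  ultimately show ?thesis by blast
qed

end

section \<open>The inequality for the inverse eigenvalues\<close>

lemma unitary_row_norm:
  assumes U: "unitary_mat r Z" and b: "b < r"
  shows "(\<Sum>a<r. (cmod (Z $$ (b, a)))\<^sup>2) = 1"
proof -
  note Z = unitary_matD[OF U]
  have "(\<Sum>a<r. Z $$ (b, a) * cnj (Z $$ (b, a))) = (Z * mat_adjoint Z) $$ (b, b)"
    using Z(1) b by (auto simp: scalar_prod_def lessThan_atLeast0)
  also have "\<dots> = 1" using Z(3) b by simp
  finally have "complex_of_real (\<Sum>a<r. (cmod (Z $$ (b, a)))\<^sup>2) = 1"
    by (simp add: complex_norm_square[symmetric] del: of_real_power)
  then show ?thesis using of_real_eq_1_iff by blast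
qed

text \<open>\<open>Y\<close> stands for a power of \<open>T\<close> in an eigenbasis of
  \<open>A\<close>. Since it preserves the form of \<open>A\<close>, its leading block, rescaled by
  square roots of eigenvalues, is a unitary matrix \<open>Z\<close>. That row \<open>b\<close> of
  \<open>Z\<close> is a unit vector expresses \<open>1 / t b\<close> through row \<open>b\<close> of
  \<open>Y\<close>.\<close>

lemma trace_inequality:
  fixes t :: "nat \<Rightarrow> real"
  assumes Y: "Y \<in> carrier_mat d d" and r: "r \<le> d"
    and pos: "\<And>i. i < r \<Longrightarrow> 0 < t i" and zero: "\<And>i. r \<le> i \<Longrightarrow> i < d \<Longrightarrow> t i = 0"
    and inv: "mat_adjoint Y * mat_diag d (\<lambda>i. complex_of_real (t i)) * Y = mat_diag d (\<lambda>i. complex_of_real (t i))"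
  shows "(\<Sum>b<r. 1 / t b) \<le> (\<Sum>a<r. (1 / t a) * (\<Sum>b<d. (cmod (Y $$ (b, a)))\<^sup>2))"
proof -
  \<comment> \<open>Entry \<open>(a', a)\<close> of the invariance identity. Rows from
    \<open>r\<close> on carry eigenvalue 0, so only the leading block takes part.\<close>
  have entry: "(\<Sum>b<r. t b * (Y $$ (b, a) * cnj (Y $$ (b, a')))) = (if a = a' then t a else 0)"
    if "a < r" "a' < r" for a a'
  proof -
    have "(mat_adjoint Y * (mat_diag d (\<lambda>i. complex_of_real (t i)) * Y)) $$ (a', a) =
        (\<Sum>b<d. t b * (Y $$ (b, a) * cnj (Y $$ (b, a'))))"
      using Y that r by (auto simp: mat_diag_mult_left[of _ d d] scalar_prod_def lessThan_atLeast0 intro!: sum.cong)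
    also have "mat_adjoint Y * (mat_diag d (\<lambda>i. complex_of_real (t i)) * Y) = mat_diag d (\<lambda>i. complex_of_real (t i))"
      using Y inv by (subst assoc_mult_mat[symmetric, of _ d d _ d _ d]) auto
    also have "(\<Sum>b<d. t b * (Y $$ (b, a) * cnj (Y $$ (b, a')))) = (\<Sum>b<r. t b * (Y $$ (b, a) * cnj (Y $$ (b, a'))))"
      using r zero by (intro sum.mono_neutral_right) auto
    finally show ?thesis using that r by (auto simp: mat_diag_def)
  qed
  \<comment> \<open>The leading block relative to the rescaled eigenvectors
    \<open>w\<^sub>a = u\<^sub>a / sqrt (t a)\<close>.\<close>
  define Z where "Z = mat r r (\<lambda>(b, a). complex_of_real (sqrt (t b) / sqrt (t a)) * Y $$ (b, a))"
  have "mat_adjoint Z * Z = 1\<^sub>m r"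
  proof (rule eq_matI)
    fix i j assume "i < dim_row (1\<^sub>m r :: complex mat)" "j < dim_col (1\<^sub>m r :: complex mat)"
    then have ij: "i < r" "j < r" by auto
    have "(mat_adjoint Z * Z) $$ (i, j) = (\<Sum>b<r. cnj (Z $$ (b, i)) * Z $$ (b, j))"
      using ij by (auto simp: Z_def scalar_prod_def lessThan_atLeast0)
    also have "\<dots> = (\<Sum>b<r. complex_of_real (1 / (sqrt (t i) * sqrt (t j))) * (t b * (Y $$ (b, j) * cnj (Y $$ (b, i)))))"
    proof (rule sum.cong)
      fix b assume "b \<in> {..<r}"
      then have b: "b < r" by simp
      have "complex_of_real (sqrt (t b)) * complex_of_real (sqrt (t b)) = complex_of_real (t b)"
        using pos[OF b] by (simp flip: of_real_mult)
      then show "cnj (Z $$ (b, i)) * Z $$ (b, j) = 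
          complex_of_real (1 / (sqrt (t i) * sqrt (t j))) * (t b * (Y $$ (b, j) * cnj (Y $$ (b, i))))"
        using b ij by (simp add: Z_def field_simps)
    qed simp
    also have "\<dots> = complex_of_real (1 / (sqrt (t i) * sqrt (t j))) * (if j = i then t j else 0)"
      unfolding sum_distrib_left[symmetric] entry[OF ij(2,1)] ..
    also have "\<dots> = (1\<^sub>m r :: complex mat) $$ (i, j)"
      using pos[OF ij(1)] ij by (auto simp flip: of_real_mult)
    finally show "(mat_adjoint Z * Z) $$ (i, j) = (1\<^sub>m r :: complex mat) $$ (i, j)" .
  qed (auto simp: Z_def)
  then have Z: "unitary_mat r Z" by (simp add: unitary_mat_def Z_def)
  have "(\<Sum>b<r. 1 / t b) = (\<Sum>b<r. \<Sum>a<r. (1 / t a) * (cmod (Y $$ (b, a)))\<^sup>2)"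
  proof (rule sum.cong)
    fix b assume "b \<in> {..<r}"
    then have b: "b < r" by simp
    have "1 / t b = (1 / t b) * (\<Sum>a<r. (cmod (Z $$ (b, a)))\<^sup>2)"
      by (simp add: unitary_row_norm[OF Z b])
    also have "\<dots> = (\<Sum>a<r. (1 / t a) * (cmod (Y $$ (b, a)))\<^sup>2)"
      unfolding sum_distrib_left
    proof (rule sum.cong)
      fix a assume "a \<in> {..<r}"
      then have a: "a < r" by simp
      have "(cmod (Z $$ (b, a)))\<^sup>2 = t b / t a * (cmod (Y $$ (b, a)))\<^sup>2"
        using pos[OF a] pos[OF b] a b by (simp add: Z_def norm_mult norm_divide power_mult_distrib power_divide)
      then show "1 / t b * (cmod (Z $$ (b, a)))\<^sup>2 = 1 / t a * (cmod (Y $$ (b, a)))\<^sup>2"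
        using pos[OF a] pos[OF b] by simp
    qed simp
    finally show "1 / t b = (\<Sum>a<r. (1 / t a) * (cmod (Y $$ (b, a)))\<^sup>2)" .
  qed simp
  also have "\<dots> = (\<Sum>a<r. (1 / t a) * (\<Sum>b<r. (cmod (Y $$ (b, a)))\<^sup>2))"
    unfolding sum_distrib_left by (rule sum.swap)
  \<comment> \<open>The added rows are the components in the kernel of \<open>A\<close>; this is
    where equality is lost.\<close>
  also have "\<dots> \<le> (\<Sum>a<r. (1 / t a) * (\<Sum>b<d. (cmod (Y $$ (b, a)))\<^sup>2))"
    using pos r by (intro sum_mono mult_left_mono sum_mono2) (auto simp: less_imp_le)
  finally show ?thesis .
qed

text \<open>Condition (iii). A list records multiplicities, and its entries are real so that they
  can be compared.\<close>

definition inverse_trace_bound :: "nat \<Rightarrow> complex mat \<Rightarrow> bool" where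
  "inverse_trace_bound k A \<longleftrightarrow> (\<exists>ts :: real list. length ts = k \<and>
     nonzero_eigenvalues A = mset (map complex_of_real ts) \<and> (\<Sum>t\<leftarrow>ts. 1 / t) \<le> real k)"

context mean_orbit_limit
begin

text \<open>The trace inequality bounds the same weighted sum of squared norms from below for every
  power. Means preserve lower bounds, and the mean of that sum is \<open>r\<close>.\<close>

lemma sum_inverse_eigenvalues_le:
  fixes t :: "nat \<Rightarrow> real"
  assumes U: "unitary_mat d U" and AU: "A = U * mat_diag d (\<lambda>i. complex_of_real (t i)) * mat_adjoint U"
    and r: "r \<le> d" and pos: "\<And>i. i < r \<Longrightarrow> 0 < t i" and zero: "\<And>i. r \<le> i \<Longrightarrow> i < d \<Longrightarrow> t i = 0"
  shows "(\<Sum>i<r. 1 / t i) \<le> real r"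
proof -
  let ?D = "mat_diag d (\<lambda>i. complex_of_real (t i))"
  note U' = unitary_matD[OF U]
  have un_adj: "unitary_mat d (mat_adjoint U)" using U' by (simp add: unitary_mat_def)
  have A_inv: "mat_adjoint (T ^\<^sub>m n) * A * T ^\<^sub>m n = A" for n
  proof (rule mat_eq_by_form[of _ d d])
    fix x y :: "complex vec" assume x: "x \<in> carrier_vec d" and y: "y \<in> carrier_vec d"
    have "(mat_adjoint (T ^\<^sub>m n) * A * T ^\<^sub>m n *\<^sub>v x) \<bullet>c y = (mat_adjoint (T ^\<^sub>m n) * (A * T ^\<^sub>m n) *\<^sub>v x) \<bullet>c y"
      using Tn[of n] A by (subst assoc_mult_mat[of _ d d _ d _ d]) auto
    also have "\<dots> = (A * T ^\<^sub>m n *\<^sub>v x) \<bullet>c (T ^\<^sub>m n *\<^sub>v y)"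
      using Tn[of n] A x y by (intro cscalar_prod_adjoint'[symmetric, of _ d d _ d]) auto
    also have "A * T ^\<^sub>m n *\<^sub>v x = A *\<^sub>v (T ^\<^sub>m n *\<^sub>v x)"
      using Tn[of n] A x by (intro assoc_mult_mat_vec) auto
    finally show "(mat_adjoint (T ^\<^sub>m n) * A * T ^\<^sub>m n *\<^sub>v x) \<bullet>c y = (A *\<^sub>v x) \<bullet>c y"
      by (simp add: invariant[OF x y])
  qed (use Tn[of n] A in \<open>auto intro!: mult_carrier_mat[of _ d d]\<close>)
  \<comment> \<open>The n-th power of \<open>T\<close> written in the eigenbasis of
    \<open>A\<close>.\<close>
  define Y where "Y n = mat_adjoint U * (T ^\<^sub>m n * U)" for n
  have Y: "Y n \<in> carrier_mat d d" for n
    unfolding Y_def using U'(1) Tn[of n] by (intro mult_carrier_mat[of _ d d]) auto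
  have UY: "U * Y n = T ^\<^sub>m n * U" for n
    unfolding Y_def using U' Tn[of n]
    by (subst assoc_mult_mat[symmetric, of _ d d _ d _ d]) (auto intro!: left_mult_one_mat mult_carrier_mat[of _ d d])
  have Y_inv: "mat_adjoint (Y n) * ?D * Y n = ?D" for n
  proof -
    have adjUY: "mat_adjoint (Y n) * mat_adjoint U = mat_adjoint U * mat_adjoint (T ^\<^sub>m n)"
      using mat_adjoint_mult[OF U'(1) Y] mat_adjoint_mult[OF Tn U'(1)] UY[of n] by metis
    have D: "?D = mat_adjoint U * A * U"
      unfolding AU using U' by (intro mat_inverse_mult[symmetric, of _ d]) auto
    have "mat_adjoint (Y n) * ?D * Y n = mat_adjoint (Y n) * mat_adjoint U * A * (U * Y n)"
      unfolding D using U'(1) A Y[of n]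
      by (simp add: assoc_mult_mat[of _ d d _ d _ d] mult_carrier_mat[of _ d d _ d])
    also have "\<dots> = mat_adjoint U * (mat_adjoint (T ^\<^sub>m n) * A * T ^\<^sub>m n) * U"
      unfolding adjUY UY using U'(1) A Tn[of n]
      by (simp add: assoc_mult_mat[of _ d d _ d _ d] mult_carrier_mat[of _ d d _ d])
    finally show ?thesis unfolding A_inv D .
  qed
  have u: "col U a \<in> carrier_vec d" if "a < r" for a using that U'(1) r by auto
  have norm: "(cvec_norm (T ^\<^sub>m n *\<^sub>v col U a))\<^sup>2 = (\<Sum>b<d. (cmod (Y n $$ (b, a)))\<^sup>2)" if a: "a < r" for n a
  proof -
    have "col (Y n) a = mat_adjoint U *\<^sub>v (T ^\<^sub>m n *\<^sub>v col U a)"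
      unfolding Y_def using U'(1) Tn[of n] a r by (simp add: col_mult2[of _ d d _ d] del: col_mult)
    then have "cvec_norm (col (Y n) a) = cvec_norm (T ^\<^sub>m n *\<^sub>v col U a)"
      using cvec_norm_unitary_mult[OF un_adj, of "T ^\<^sub>m n *\<^sub>v col U a"] Tn[of n] u[OF a] by simp
    then show ?thesis
      using Y[of n] a r cvec_norm_power2[of "col (Y n) a" d] by (auto intro!: sum.cong)
  qed
  \<comment> \<open>The weights turn \<open>u\<^sub>a\<close> into \<open>w\<^sub>a\<close>, at
    which the form of \<open>A\<close> is 1; so each summand has mean 1.\<close>
  let ?s = "\<lambda>n. \<Sum>a<r. complex_of_real (1 / t a) * ((T ^\<^sub>m Suc n *\<^sub>v col U a) \<bullet>c (T ^\<^sub>m Suc n *\<^sub>v col U a))"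
  have "M ?s (\<Sum>a<r. complex_of_real (1 / t a) * ((A *\<^sub>v col U a) \<bullet>c col U a))"
    using u by (intro sum scale mean_orbit) auto
  moreover have "complex_of_real (\<Sum>b<r. 1 / t b) \<le> ?s n" for n
  proof -
    have "?s n = complex_of_real (\<Sum>a<r. (1 / t a) * (\<Sum>b<d. (cmod (Y (Suc n) $$ (b, a)))\<^sup>2))"
      unfolding cscalar_prod_self of_real_sum of_real_mult by (intro sum.cong refl) (simp add: norm del: pow_mat.simps of_real_power)
    moreover have "(\<Sum>b<r. 1 / t b) \<le> (\<Sum>a<r. (1 / t a) * (\<Sum>b<d. (cmod (Y (Suc n) $$ (b, a)))\<^sup>2))"
      by (rule trace_inequality[OF Y r pos zero Y_inv])
    ultimately show ?thesis by (simp only: less_eq_complex_def Re_complex_of_real Im_complex_of_real)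
  qed
  ultimately have "complex_of_real (\<Sum>b<r. 1 / t b) \<le> (\<Sum>a<r. complex_of_real (1 / t a) * ((A *\<^sub>v col U a) \<bullet>c col U a))"
    by (rule lower_bound)
  also have "\<dots> = (\<Sum>a<r. 1)"
  proof (rule sum.cong)
    fix a assume "a \<in> {..<r}"
    then have a: "a < r" by simp
    have "(A *\<^sub>v col U a) \<bullet>c col U a = (mat_adjoint U * (A * U)) $$ (a, a)"
      using U'(1) A a r by (subst index_adjoint_mult[of _ d d _ d]) (auto simp: col_mult2[of _ d d _ d] simp del: col_mult)
    also have "mat_adjoint U * (A * U) = mat_adjoint U * A * U"
      using U'(1) A by (subst assoc_mult_mat[of _ d d _ d _ d]) auto
    also have "\<dots> = ?D"
      unfolding AU using U' by (intro mat_inverse_mult[of _ d]) auto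
    finally show "complex_of_real (1 / t a) * ((A *\<^sub>v col U a) \<bullet>c col U a) = 1"
      using pos[OF a] a r by (simp add: mat_diag_def)
  qed simp
  finally show ?thesis by (simp add: less_eq_complex_def)
qed

text \<open>Stability determines the rank: the stable subspace is the kernel of \<open>A\<close>,
  whose dimension is \<open>d - r\<close> for \<open>r\<close> nonzero eigenvalues.\<close>

lemma inverse_trace_boundI:
  assumes "l_stable l T" "l \<le> d"
  shows "inverse_trace_bound (d - l) A"
proof -
  obtain U t r where U: "unitary_mat d U" and AU: "A = U * mat_diag d (\<lambda>i. complex_of_real (t i)) * mat_adjoint U"
    and r: "r \<le> d" and pos: "\<And>i. i < r \<Longrightarrow> 0 < t i" and zero: "\<And>i. r \<le> i \<Longrightarrow> i < d \<Longrightarrow> t i = 0"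
    and ev: "nonzero_eigenvalues A = mset (map (\<lambda>i. complex_of_real (t i)) [0..<r])"
    using pos_semidef_spectral[OF orbit_limit_pos_semidef[OF lim]] by metis
  note U' = unitary_matD[OF U]
  have "kernel.dim d A = d - r"
    unfolding AU using U' r zero
    by (intro kernel_dim_mult_diag[of U d "mat_adjoint U" "mat_adjoint U" U]) (auto dest: pos)
  then have "l = d - r"
    using assms(1) T by (simp add: l_stable_def subspace_dim_def stable_subspace_eq_kernel)
  then have "d - l = r" using r by simp
  moreover have "(\<Sum>i<r. 1 / t i) \<le> real r"
    by (rule sum_inverse_eigenvalues_le[OF U AU r pos zero])
  moreover have "(\<Sum>s\<leftarrow>map t [0..<r]. 1 / s) = (\<Sum>i<r. 1 / t i)"
    by (simp add: sum_list_sum_nth o_def lessThan_atLeast0)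
  ultimately show ?thesis
    unfolding inverse_trace_bound_def ev by (intro exI[of _ "map t [0..<r]"]) (simp add: o_def)
qed

end

section \<open>Cesaro means and Banach limits\<close>

lemma cesaro_generalized_mean:
  "generalized_mean (\<lambda>s a. (\<lambda>n. 1 / of_nat n * (\<Sum>j<n. s j)) \<longlonglongrightarrow> (a :: complex))"
proof
  fix s t :: "nat \<Rightarrow> complex" and a b c z
  let ?m = "\<lambda>s n. 1 / complex_of_nat n * (\<Sum>j<n. s j)"
  show "?m (\<lambda>n. s n + t n) \<longlonglongrightarrow> a + b" if "?m s \<longlonglongrightarrow> a" "?m t \<longlonglongrightarrow> b"
    using tendsto_add[OF that] by (simp add: sum.distrib distrib_left)
  show "?m (\<lambda>n. c * s n) \<longlonglongrightarrow> c * a" if "?m s \<longlonglongrightarrow> a"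
    using tendsto_mult_left[OF that, of c] by (simp add: sum_distrib_left mult.left_commute)
  show "a = b" if "?m s \<longlonglongrightarrow> a" "?m s \<longlonglongrightarrow> b"
    using that by (rule LIMSEQ_unique)
  show "?m (\<lambda>n. s (Suc n)) \<longlonglongrightarrow> a" if s: "Bseq s" and lim: "?m s \<longlonglongrightarrow> a"
  proof -
    obtain K where K: "\<And>n. cmod (s n) \<le> K" using s by (auto simp: Bseq_def)
    \<comment> \<open>By telescoping, this is the difference between the averages of the shifted and
      of the original sequence.\<close>
    have "(\<lambda>n. 1 / complex_of_nat n * (s n - s 0)) \<longlonglongrightarrow> 0"
    proof (rule tendsto_0_le[OF lim_1_over_n])
      show "\<forall>\<^sub>F n in sequentially. cmod (1 / complex_of_nat n * (s n - s 0)) \<le> norm (1 / real n) * (2 * K)"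
      proof (intro always_eventually allI)
        fix n
        have "cmod (s n - s 0) \<le> 2 * K"
          using norm_triangle_ineq4[of "s n" "s 0"] K[of n] K[of 0] by simp
        then show "cmod (1 / complex_of_nat n * (s n - s 0)) \<le> norm (1 / real n) * (2 * K)"
          by (simp add: norm_mult norm_divide divide_right_mono)
      qed
    qed
    moreover have "(\<Sum>j<n. s (Suc j)) = (\<Sum>j<n. s j) + (s n - s 0)" for n
      by (induction n) auto
    ultimately show ?thesis
      using tendsto_add[OF lim, of "\<lambda>n. 1 / complex_of_nat n * (s n - s 0)" 0] by (simp add: distrib_left add_divide_distrib)
  qed
  show "0 \<le> a" if lim: "?m s \<longlonglongrightarrow> a" and "\<And>n. 0 \<le> s n"
  proof -
    \<comment> \<open>In the complex order a nonnegative number is real, so the imaginary part of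
      the limit has to be shown to vanish as well.\<close>
    have re: "0 \<le> Re (?m s n)" and im: "Im (?m s n) = 0" for n
      using that(2) by (auto simp: less_eq_complex_def sum_nonneg Re_divide_of_nat Im_divide_of_nat)
    have "0 \<le> Re a" using re by (intro LIMSEQ_le_const[OF tendsto_Re[OF lim]]) blast
    moreover have "(\<lambda>n. Im (?m s n)) \<longlonglongrightarrow> 0" unfolding im by (rule tendsto_const)
    then have "Im a = 0" by (rule LIMSEQ_unique[OF tendsto_Im[OF lim]])
    ultimately show ?thesis by (simp add: less_eq_complex_def)
  qed
  show "?m (\<lambda>n. z ^ Suc n) \<longlonglongrightarrow> (if z = 1 then 1 else 0)" if z: "cmod z = 1"
  proof (cases "z = 1")
    case True
    \<comment> \<open>Only eventually: at \<open>n = 0\<close> the average is 0, by the convention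
      for division by zero.\<close>
    have "\<forall>\<^sub>F n in sequentially. ?m (\<lambda>n. 1) n = 1"
      using eventually_gt_at_top[of 0] by eventually_elim simp
    then show ?thesis using True by (simp add: tendsto_eventually)
  next
    case False
    have "?m (\<lambda>n. z ^ Suc n) \<longlonglongrightarrow> 0"
    proof (rule tendsto_0_le[OF lim_1_over_n])
      show "\<forall>\<^sub>F n in sequentially. cmod (?m (\<lambda>n. z ^ Suc n) n) \<le> norm (1 / real n) * (2 / cmod (z - 1))"
      proof (intro always_eventually allI)
        fix n
        \<comment> \<open>The partial sums of a geometric sequence on the unit circle stay bounded
          when \<open>z \<noteq> 1\<close>, so their averages tend to 0.\<close>
        have "(\<Sum>j<n. z ^ Suc j) = z * ((z ^ n - 1) / (z - 1))"
          using geometric_sum[OF False, of n] by (simp add: sum_distrib_left[symmetric])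
        moreover have "cmod (z ^ n - 1) \<le> 2"
          using norm_triangle_ineq4[of "z ^ n" 1] z by (simp add: norm_power)
        ultimately have "cmod (\<Sum>j<n. z ^ Suc j) \<le> 2 / cmod (z - 1)"
          using z by (simp add: norm_mult norm_divide divide_right_mono)
        then have "norm (1 / real n) * cmod (\<Sum>j<n. z ^ Suc j) \<le> norm (1 / real n) * (2 / cmod (z - 1))"
          by (rule mult_left_mono) simp
        then show "cmod (?m (\<lambda>n. z ^ Suc n) n) \<le> norm (1 / real n) * (2 / cmod (z - 1))"
          by (simp only: norm_mult norm_divide norm_one norm_of_nat abs_of_nat)
      qed
    qed
    then show ?thesis using False by simp
  qed
qed

text \<open>Exponents \<open>j = 1..n\<close> become \<open>Suc j\<close> with \<open>j < n\<close>,
  and \<open>orbit_limit_iff_entries\<close> passes from entries to forms.\<close>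

lemma has_cesaro_asymptotic_limit_iff:
  assumes T: "T \<in> carrier_mat d d" and A: "A \<in> carrier_mat d d"
  shows "has_cesaro_asymptotic_limit T A \<longleftrightarrow>
    orbit_limit (\<lambda>s a. (\<lambda>n. 1 / of_nat n * (\<Sum>j<n. s j)) \<longlonglongrightarrow> a) d T A"
  unfolding generalized_mean.orbit_limit_iff_entries[OF cesaro_generalized_mean T A]
    has_cesaro_asymptotic_limit_def mat_adjoint_pow[OF T]
  using T A by (simp add: sum.atLeast1_atMost_eq del: pow_mat.simps)

text \<open>\<open>Bseq\<close> is part of the relation because the values of \<open>L\<close> at
  unbounded sequences are arbitrary. Apart from \<open>geometric\<close>, the axioms are read off
  from the definition.\<close>

lemma banach_generalized_mean:
  assumes L: "banach_limit L"
  shows "generalized_mean (\<lambda>s a. Bseq s \<and> L s = a)"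
proof
  fix s t :: "nat \<Rightarrow> complex" and a b c z
  have L_add: "Bseq x \<Longrightarrow> Bseq y \<Longrightarrow> L (\<lambda>n. x n + y n) = L x + L y"
    and L_scale: "Bseq x \<Longrightarrow> L (\<lambda>n. e * x n) = e * L x"
    and L_lim: "x \<longlonglongrightarrow> f \<Longrightarrow> L x = f"
    and L_pos: "Bseq x \<Longrightarrow> (\<And>n. 0 \<le> x n) \<Longrightarrow> 0 \<le> L x"
    and L_shift: "Bseq x \<Longrightarrow> L (\<lambda>n. x (Suc n)) = L x" for x y e f
    using L unfolding banach_limit_def by blast+
  show "Bseq (\<lambda>n. s n + t n) \<and> L (\<lambda>n. s n + t n) = a + b" if st: "Bseq s \<and> L s = a" "Bseq t \<and> L t = b"
  proof
    obtain K K' where "\<forall>n. cmod (s n) \<le> K" "\<forall>n. cmod (t n) \<le> K'"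
      using st unfolding Bseq_def by blast
    then show "Bseq (\<lambda>n. s n + t n)" by (intro BseqI'[of _ "K + K'"] norm_triangle_mono) auto
  qed (use st L_add in auto)
  show "Bseq (\<lambda>n. c * s n) \<and> L (\<lambda>n. c * s n) = c * a" if "Bseq s \<and> L s = a"
    using that L_scale by (auto intro: Bseq_mult)
  show "a = b" if "Bseq s \<and> L s = a" "Bseq s \<and> L s = b" using that by simp
  show "Bseq (\<lambda>n. s (Suc n)) \<and> L (\<lambda>n. s (Suc n)) = a" if "Bseq s" "Bseq s \<and> L s = a"
    using that L_shift by (simp add: Bseq_Suc_iff)
  show "0 \<le> a" if "Bseq s \<and> L s = a" "\<And>n. 0 \<le> s n" using that L_pos by auto
  show "Bseq (\<lambda>n. z ^ Suc n) \<and> L (\<lambda>n. z ^ Suc n) = (if z = 1 then 1 else 0)" if z: "cmod z = 1"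
  proof
    show B: "Bseq (\<lambda>n. z ^ Suc n)"
      using z by (intro BseqI'[of _ 1]) (simp add: norm_mult norm_power)
    show "L (\<lambda>n. z ^ Suc n) = (if z = 1 then 1 else 0)"
    proof (cases "z = 1")
      case True
      then show ?thesis using L_lim[of "\<lambda>n. 1" 1] by simp
    next
      case False
      \<comment> \<open>Multiplying the sequence by \<open>z\<close> shifts it, so shift invariance
        forces the value 0 unless \<open>z = 1\<close>.\<close>
      have "z * L (\<lambda>n. z ^ Suc n) = L (\<lambda>n. z ^ Suc n)"
        using L_scale[OF B, of z] L_shift[OF B] by simp
      then show ?thesis using False by simp
    qed
  qed
qed

text \<open>Justifies the definite description: the entrywise \<open>L\<close>-limits provide
  existence, and the form determines the matrix. Positivity in the description comes from positivity
  of the mean.\<close>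

lemma asymptotic_limit_eq_iff:
  assumes L: "banach_limit L" and T: "T \<in> carrier_mat d d" "powerbounded T"
  shows "asymptotic_limit L T = A \<longleftrightarrow> orbit_limit (\<lambda>s a. Bseq s \<and> L s = a) d T A"
proof -
  interpret generalized_mean "\<lambda>s a. Bseq s \<and> L s = a"
    by (rule banach_generalized_mean[OF L])
  let ?O = "orbit_limit (\<lambda>s a. Bseq s \<and> L s = a) d T"
  let ?G = "\<lambda>n. mat_adjoint (T ^\<^sub>m Suc n) * T ^\<^sub>m Suc n"
  let ?A = "mat d d (\<lambda>(p, q). L (\<lambda>n. ?G n $$ (p, q)))"
  have Tn: "T ^\<^sub>m n \<in> carrier_mat d d" for n using T by simp
  have "Bseq (\<lambda>n. ?G n $$ (p, q))" if "p < d" "q < d" for p q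
  proof -
    have "?G n $$ (p, q) = (T ^\<^sub>m Suc n *\<^sub>v unit_vec d q) \<bullet>c (T ^\<^sub>m Suc n *\<^sub>v unit_vec d p)" for n
      unfolding cscalar_prod_adjoint'[OF Tn Tn unit_vec_carrier unit_vec_carrier]
      using Tn[of "Suc n"] that
      by (intro cscalar_prod_unit_vec[symmetric] mult_carrier_mat[of _ d d] mat_adjoint_carrier)
    then show ?thesis using powerbounded_orbit_Bseq[OF T unit_vec_carrier unit_vec_carrier, of q p] by simp
  qed
  then have ex: "?O ?A"
    by (subst orbit_limit_iff_entries[OF T(1)]) (auto simp del: pow_mat.simps)
  have uniq: "B = C" if "?O B" "?O C" for B C
    using that by (intro mat_eq_by_form[of _ d d]) (auto simp: orbit_limit_def simp del: pow_mat.simps)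
  let ?P = "\<lambda>A. pos_semidef (dim_row T) A \<and>
    (\<forall>x \<in> carrier_vec (dim_row T). \<forall>y \<in> carrier_vec (dim_row T).
       (A *\<^sub>v x) \<bullet>c y = L (\<lambda>n. (T ^\<^sub>m Suc n *\<^sub>v x) \<bullet>c (T ^\<^sub>m Suc n *\<^sub>v y)))"
  have "?P B \<longleftrightarrow> ?O B" for B
  proof
    assume "?P B"
    then show "?O B"
      using T(1) powerbounded_orbit_Bseq[OF T] 
      by (auto simp: orbit_limit_def pos_semidef_def simp del: pow_mat.simps)
  next
    assume "?O B"
    then show "?P B"
      using T(1) orbit_limit_pos_semidef[of d T B] by (auto simp: orbit_limit_def simp del: pow_mat.simps)
  qed
  then have "?P = ?O" by (rule ext)
  then have "asymptotic_limit L T = (THE B. ?O B)"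
    unfolding asymptotic_limit_def by (rule arg_cong)
  also have "\<dots> = ?A"
    by (rule the_equality[of ?O, OF ex uniq[OF _ ex]])
  finally have lim: "asymptotic_limit L T = ?A" .
  show ?thesis unfolding lim using ex uniq[OF _ ex] by blast
qed

section \<open>Bases of unit vectors\<close>

text \<open>\<open>mat_inv\<close> is meaningful only if \<open>mat_inverse\<close> returns
  \<open>Some\<close>. That holds because an invertible \<open>S\<close> is a unit of the matrix
  ring.\<close>

lemma mat_inv_inverse:
  assumes S: "S \<in> carrier_mat d d" and inv: "invertible_mat S"
  shows "mat_inv S \<in> carrier_mat d d" "S * mat_inv S = 1\<^sub>m d" "mat_inv S * S = 1\<^sub>m d"
proof -
  \<comment> \<open>\<open>invertible_mat\<close> leaves the dimensions of the inverse open;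
    comparing column counts of the two products fixes them.\<close>
  obtain B where B: "S * B = 1\<^sub>m d" "B * S = 1\<^sub>m (dim_row B)"
    using inv S unfolding invertible_mat_def inverts_mat_def by auto
  have "dim_col B = d" using arg_cong[OF B(1), of dim_col] by simp
  moreover have "dim_row B = d" using arg_cong[OF B(2), of dim_col] S by simp
  ultimately have "B \<in> carrier_mat d d" by auto
  then have "S \<in> Units (ring_mat TYPE(complex) d ())"
    using S B by (auto simp: Units_def ring_mat_def)
  then obtain C where "mat_inverse S = Some C"
    using mat_inverse(1)[OF S, of "()"] by (cases "mat_inverse S") auto
  then show "mat_inv S \<in> carrier_mat d d" "S * mat_inv S = 1\<^sub>m d" "mat_inv S * S = 1\<^sub>m d"
    using mat_inverse(2)[OF S] by (auto simp: mat_inv_def)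
qed

lemma mat_inv_unique:
  assumes S: "S \<in> carrier_mat d d" and X: "X \<in> carrier_mat d d" and "X * S = 1\<^sub>m d"
  shows "invertible_mat S" "mat_inv S = X"
proof -
  have SX: "S * X = 1\<^sub>m d" by (rule mat_mult_left_right_inverse[OF X S assms(3)])
  then show inv: "invertible_mat S"
    using S X assms(3) unfolding invertible_mat_def inverts_mat_def by auto
  note I = mat_inv_inverse[OF S inv]
  have "mat_inv S = X * S * mat_inv S" using assms(3) I(1) by simp
  also have "\<dots> = X" using S X I by (subst assoc_mult_mat[of _ d d _ d _ d]) auto
  finally show "mat_inv S = X" .
qed

lemma mat_inv_adjoint:
  assumes S: "S \<in> carrier_mat d d" and inv: "invertible_mat S"
  shows "invertible_mat (mat_adjoint S)" "mat_inv (mat_adjoint S) = mat_adjoint (mat_inv S)"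
proof -
  note I = mat_inv_inverse[OF S inv]
  have "mat_adjoint (mat_inv S) * mat_adjoint S = 1\<^sub>m d"
    using mat_adjoint_mult[OF S I(1)] I(2) by simp
  then show "invertible_mat (mat_adjoint S)" "mat_inv (mat_adjoint S) = mat_adjoint (mat_inv S)"
    using mat_inv_unique[of "mat_adjoint S" d "mat_adjoint (mat_inv S)"] S I(1) by auto
qed

lemma diag_block_one_zero_mat:
  "diag_block_mat [1\<^sub>m k, 0\<^sub>m l l] = mat_diag (k + l) (\<lambda>i. if i < k then 1 else 0 :: complex)"
  by (rule eq_matI) (auto simp: mat_diag_def)

lemma mat_diag_pow: "mat_diag n f ^\<^sub>m m = mat_diag n (\<lambda>i. f i ^ m :: complex)"
  by (induction m) (simp_all add: carrier_matD[OF mat_diag_dim] mult.commute)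

lemma mat_diag_vec:
  "v \<in> carrier_vec d \<Longrightarrow> i < d \<Longrightarrow> (mat_diag d g *\<^sub>v v) $ i = g i * (v $ i :: complex)"
  by (auto simp: mat_diag_def scalar_prod_def sum.delta if_distrib[of "\<lambda>x. x * _"] cong: if_cong)

section \<open>Roots of unity and the Fourier matrix\<close>

definition root_of_unity :: "nat \<Rightarrow> nat \<Rightarrow> complex" where
  "root_of_unity k j = cis (2 * pi * real j / real k)"

lemma norm_root_of_unity [simp]: "cmod (root_of_unity k j) = 1"
  by (simp add: root_of_unity_def)

text \<open>On the unit circle conjugation is inversion, so the product is a ratio of two roots, and
  indices below \<open>k\<close> give distinct roots.\<close>

lemma cnj_root_of_unity_mult: "cnj (root_of_unity k i) * root_of_unity k j = 1 \<longleftrightarrow> i = j"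
  if "i < k" "j < k"
proof
  assume *: "cnj (root_of_unity k i) * root_of_unity k j = 1"
  have "root_of_unity k j = root_of_unity k i * (cnj (root_of_unity k i) * root_of_unity k j)"
    using complex_norm_square[of "root_of_unity k i"] by (simp add: mult.assoc[symmetric])
  then have "root_of_unity k i = root_of_unity k j" using * by simp
  then show "i = j"
    using bij_betw_roots_unity[of k] that unfolding bij_betw_def inj_on_def root_of_unity_def by auto
next
  assume "i = j"
  then show "cnj (root_of_unity k i) * root_of_unity k j = 1"
    using complex_norm_square[of "root_of_unity k i"] by (simp add: mult.commute)
qed

lemma root_of_unity_power: "j < k \<Longrightarrow> root_of_unity k j ^ k = 1"
  using bij_betw_roots_unity[of k] by (auto simp: bij_betw_def root_of_unity_def)

text \<open>Orthogonality of the columns of the Fourier matrix: for \<open>i \<noteq> j\<close> this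
  is a full geometric sum over a k-th root of unity other than 1.\<close>

lemma sum_root_of_unity_powers:
  assumes "i < k" "j < k"
  shows "(\<Sum>a<k. cnj (root_of_unity k i ^ a) * root_of_unity k j ^ a) = (if i = j then of_nat k else 0)"
proof -
  let ?z = "cnj (root_of_unity k i) * root_of_unity k j"
  have sum: "(\<Sum>a<k. cnj (root_of_unity k i ^ a) * root_of_unity k j ^ a) = (\<Sum>a<k. ?z ^ a)"
    by (simp add: power_mult_distrib)
  show ?thesis
  proof (cases "i = j")
    case True
    then have "?z = 1" using cnj_root_of_unity_mult[OF assms] by simp
    then show ?thesis using True unfolding sum by simp
  next
    case False
    then have "?z \<noteq> 1" using cnj_root_of_unity_mult[OF assms] by simp
    moreover have "?z ^ k = 1"
      using assms by (simp add: power_mult_distrib root_of_unity_power flip: complex_cnj_power)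
    ultimately show ?thesis using False unfolding sum by (simp add: geometric_sum)
  qed
qed

section \<open>A powerbounded matrix built from a basis of unit vectors\<close>

locale normalized_basis =
  fixes d k :: nat and S S' :: "complex mat"
  assumes S: "S \<in> carrier_mat d d" and S': "S' \<in> carrier_mat d d"
    and SS': "S * S' = 1\<^sub>m d" and S'S: "S' * S = 1\<^sub>m d"
    and unit_cols: "\<And>j. j < d \<Longrightarrow> cvec_norm (col S j) = 1"
    and k: "k \<le> d"
begin

text \<open>The eigenvalues of \<open>T\<close>. The first \<open>k\<close> are unimodular and
  pairwise distinct, so that mixed terms average to 0; the zeros make \<open>T\<close> vanish on the
  remaining columns of \<open>S\<close>.\<close>

definition phase :: "nat \<Rightarrow> complex" where "phase i = (if i < k then root_of_unity k i else 0)"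

definition T :: "complex mat" where "T = S * mat_diag d phase * S'"

definition A :: "complex mat" where
  "A = mat_adjoint S' * mat_diag d (\<lambda>i. if i < k then 1 else 0) * S'"

lemma T: "T \<in> carrier_mat d d"
  unfolding T_def using S S' by (intro mult_carrier_mat[of _ d d]) auto

lemma A: "A \<in> carrier_mat d d"
  unfolding A_def using S' by (intro mult_carrier_mat[of _ d d]) auto

lemma T_pow: "T ^\<^sub>m n = S * mat_diag d (\<lambda>i. phase i ^ n) * S'"
proof -
  have "similar_mat_wit T (mat_diag d phase) S S'"
    using S S' SS' S'S T by (intro similar_mat_witI[of _ _ d]) (auto simp: T_def)
  from similar_mat_wit_pow_id[OF this, of n] show ?thesis unfolding mat_diag_pow .
qed

lemma T_pow_vec:
  "x \<in> carrier_vec d \<Longrightarrow> T ^\<^sub>m n *\<^sub>v x = S *\<^sub>v (mat_diag d (\<lambda>i. phase i ^ n) *\<^sub>v (S' *\<^sub>v x))"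
  unfolding T_pow using S S'
  by (simp add: assoc_mult_mat_vec[of _ d d _ d] mult_carrier_mat[of _ d d])

text \<open>The powers of \<open>T\<close> are conjugates of diagonal contractions by the same
  \<open>S\<close>, so one constant bounds them all.\<close>

lemma powerbounded: "powerbounded T"
proof -
  obtain K where K: "0 \<le> K" "\<And>x. x \<in> carrier_vec d \<Longrightarrow> cvec_norm (S *\<^sub>v x) \<le> K * cvec_norm x"
    using mult_mat_vec_bounded[OF S] by blast
  obtain K' where K': "0 \<le> K'" "\<And>x. x \<in> carrier_vec d \<Longrightarrow> cvec_norm (S' *\<^sub>v x) \<le> K' * cvec_norm x"
    using mult_mat_vec_bounded[OF S'] by blast
  have contraction: "cvec_norm (mat_diag d (\<lambda>i. phase i ^ n) *\<^sub>v v) \<le> cvec_norm v" 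
    if v: "v \<in> carrier_vec d" for n v
  proof -
    have "cmod (phase i ^ n) \<le> 1" for i
      by (cases n) (auto simp: phase_def norm_power norm_mult)
    then have "cmod ((mat_diag d (\<lambda>i. phase i ^ n) *\<^sub>v v) $ i) \<le> cmod (v $ i)" if "i < d" for i
      unfolding mat_diag_vec[OF v that] norm_mult by (rule mult_left_le_one_le[OF norm_ge_zero norm_ge_zero])
    then show ?thesis
      unfolding cvec_norm_L2_set[OF v] cvec_norm_L2_set[OF mult_mat_vec_carrier[OF mat_diag_dim v]]
      by (intro L2_set_mono) auto
  qed
  have "cvec_norm (T ^\<^sub>m n *\<^sub>v x) \<le> K * K' * cvec_norm x" if x: "x \<in> carrier_vec d" for n x
  proof -
    let ?v = "mat_diag d (\<lambda>i. phase i ^ n) *\<^sub>v (S' *\<^sub>v x)"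
    have S'x: "S' *\<^sub>v x \<in> carrier_vec d" using S' x by simp
    have "cvec_norm (T ^\<^sub>m n *\<^sub>v x) \<le> K * cvec_norm ?v"
      unfolding T_pow_vec[OF x] using S'x by (intro K(2) mult_mat_vec_carrier[OF mat_diag_dim])
    also have "\<dots> \<le> K * cvec_norm (S' *\<^sub>v x)"
      by (intro mult_left_mono contraction S'x K(1))
    also have "\<dots> \<le> K * (K' * cvec_norm x)"
      by (intro mult_left_mono K'(2) x K(1))
    finally show ?thesis by (simp add: mult.assoc)
  qed
  then show ?thesis unfolding powerbounded_iff[OF T] by blast
qed

text \<open>In the coordinates given by \<open>S'\<close>, entry \<open>(i, j)\<close> of the Gram
  matrix of \<open>S\<close> is multiplied by the n-th power of
  \<open>cnj (phase i) * phase j\<close>. The mean removes the entries off the diagonal and keeps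
  the first \<open>k\<close> diagonal ones, which are 1 because the columns of \<open>S\<close> are
  unit vectors.\<close>

lemma orbit_limit_T:
  assumes "generalized_mean M"
  shows "orbit_limit M d T A"
proof -
  interpret generalized_mean M by fact
  let ?P = "mat_diag d (\<lambda>i. if i < k then 1 else 0 :: complex)"
  let ?G = "mat_adjoint S * S"
  have G: "?G \<in> carrier_mat d d" using S by (intro mult_carrier_mat[of _ d d]) auto
  have G1: "?G $$ (i, i) = 1" if "i < d" for i
    unfolding index_adjoint_mult[OF S S that that] cscalar_prod_self unit_cols[OF that] by simp
  have "M (\<lambda>n. (T ^\<^sub>m Suc n *\<^sub>v x) \<bullet>c (T ^\<^sub>m Suc n *\<^sub>v y)) ((A *\<^sub>v x) \<bullet>c y)"
    if x: "x \<in> carrier_vec d" and y: "y \<in> carrier_vec d" for x y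
  proof -
    define u where "u = S' *\<^sub>v x"
    define v where "v = S' *\<^sub>v y"
    have u: "u \<in> carrier_vec d" and v: "v \<in> carrier_vec d" using S' x y by (auto simp: u_def v_def)
    have Dc: "mat_diag d (\<lambda>i. phase i ^ n) *\<^sub>v w \<in> carrier_vec d" if "w \<in> carrier_vec d" for n w
      using that by (intro mult_mat_vec_carrier[OF mat_diag_dim])
    have orbit: "(T ^\<^sub>m n *\<^sub>v x) \<bullet>c (T ^\<^sub>m n *\<^sub>v y) = 
        (\<Sum>i<d. \<Sum>j<d. ?G $$ (i, j) * (phase j ^ n * u $ j) * cnj (phase i ^ n * v $ i))" for n
    proof -
      have "(T ^\<^sub>m n *\<^sub>v x) \<bullet>c (T ^\<^sub>m n *\<^sub>v y) = 
          (?G *\<^sub>v (mat_diag d (\<lambda>i. phase i ^ n) *\<^sub>v u)) \<bullet>c (mat_diag d (\<lambda>i. phase i ^ n) *\<^sub>v v)"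
        unfolding T_pow_vec[OF x] T_pow_vec[OF y] u_def[symmetric] v_def[symmetric]
        by (rule cscalar_prod_adjoint'[OF S S Dc[OF u] Dc[OF v]])
      also have "\<dots> = (\<Sum>i<d. \<Sum>j<d. ?G $$ (i, j) * (phase j ^ n * u $ j) * cnj (phase i ^ n * v $ i))"
        unfolding mult_mat_vec_cscalar_prod[OF G Dc[OF u] Dc[OF v]]
        by (intro sum.cong refl) (simp add: mat_diag_vec[OF u] mat_diag_vec[OF v])
      finally show ?thesis .
    qed
    have limit: "(A *\<^sub>v x) \<bullet>c y = (\<Sum>i<d. \<Sum>j<d. ?P $$ (i, j) * u $ j * cnj (v $ i))"
    proof -
      have PS': "?P * S' \<in> carrier_mat d d" using S' by (intro mult_carrier_mat[of _ d d]) auto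
      have "A = mat_adjoint S' * (?P * S')"
        unfolding A_def using S' by (intro assoc_mult_mat) auto
      then have "(A *\<^sub>v x) \<bullet>c y = ((?P * S') *\<^sub>v x) \<bullet>c v"
        unfolding v_def by (simp only: cscalar_prod_adjoint'[OF PS' S' x y])
      also have "(?P * S') *\<^sub>v x = ?P *\<^sub>v u"
        unfolding u_def by (rule assoc_mult_mat_vec[OF mat_diag_dim S' x])
      finally show ?thesis unfolding mult_mat_vec_cscalar_prod[OF mat_diag_dim u v] .
    qed
    have "M (\<lambda>n. ?G $$ (i, j) * (phase j ^ Suc n * u $ j) * cnj (phase i ^ Suc n * v $ i)) 
            (?P $$ (i, j) * u $ j * cnj (v $ i))" if i: "i < d" and j: "j < d" for i j
    proof (cases "i < k \<and> j < k")
      case True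
      let ?z = "cnj (phase i) * phase j"
      have z1: "?z = 1 \<longleftrightarrow> i = j"
        using cnj_root_of_unity_mult[of i k j] True by (simp add: phase_def)
      have "cmod ?z = 1" using True by (simp add: phase_def norm_mult)
      from scale[OF geometric[OF this], of "?G $$ (i, j) * u $ j * cnj (v $ i)"]
      have "M (\<lambda>n. ?G $$ (i, j) * u $ j * cnj (v $ i) * ?z ^ Suc n) 
          (?G $$ (i, j) * u $ j * cnj (v $ i) * (if i = j then 1 else 0))"
        unfolding z1 .
      moreover have "?G $$ (i, j) * u $ j * cnj (v $ i) * (if i = j then 1 else 0) = ?P $$ (i, j) * u $ j * cnj (v $ i)"
        using G1[OF i] True i j by (auto simp: mat_diag_def)
      moreover have "?G $$ (i, j) * u $ j * cnj (v $ i) * ?z ^ n = 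
          ?G $$ (i, j) * (phase j ^ n * u $ j) * cnj (phase i ^ n * v $ i)" for n
        by (simp add: power_mult_distrib)
      ultimately show ?thesis by (simp only:)
    next
      case False
      \<comment> \<open>One of the two phases is 0, and the exponent \<open>Suc n\<close> is
        positive, so no term \<open>0 ^ 0\<close> occurs.\<close>
      then have "?G $$ (i, j) * (phase j ^ Suc n * u $ j) * cnj (phase i ^ Suc n * v $ i) = 0" for n
        by (auto simp: phase_def)
      moreover have "?P $$ (i, j) = 0" using False i j by (auto simp: mat_diag_def)
      ultimately show ?thesis using const[of 0] by (simp only: mult_zero_left)
    qed
    then show ?thesis unfolding orbit limit by (intro sum) auto
  qed
  then show ?thesis using A by (simp add: orbit_limit_def)
qed

text \<open>The mean identifies the stable subspace with the kernel of \<open>A\<close>, and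
  \<open>A\<close> is congruent to a diagonal projection of rank \<open>k\<close>.\<close>

lemma l_stable_T:
  assumes "generalized_mean M"
  shows "l_stable (d - k) T"
proof -
  interpret mean_orbit_limit M d T A
    using assms T powerbounded orbit_limit_T[OF assms] 
    by (intro mean_orbit_limit.intro mean_orbit_limit_axioms.intro)
  have adj: "mat_adjoint S * mat_adjoint S' = 1\<^sub>m d"
    using mat_adjoint_mult[OF S' S] S'S by simp
  have "kernel.dim d A = d - k"
    unfolding A_def using S S' S'S k adj
    by (intro kernel_dim_mult_diag[of _ d "mat_adjoint S" _ S]) auto
  then show ?thesis
    using T by (simp add: l_stable_def subspace_dim_def stable_subspace_eq_kernel)
qed

end

text \<open>Take \<open>S = U * C\<close>, where \<open>C\<close> holds the coordinates of the new
  basis in the eigenbasis of \<open>A\<close>. Since \<open>U\<close> is unitary, both the norms of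
  the columns and the congruence can be checked on \<open>C\<close> and the diagonal matrix of
  eigenvalues.\<close>

lemma normalized_basis_of_inverse_trace_bound:
  assumes psd: "pos_semidef d A" and bound: "inverse_trace_bound k A" and k: "0 < k" "k < d"
  shows "\<exists>S \<in> carrier_mat d d. invertible_mat S \<and> (\<forall>j<d. cvec_norm (col S j) = 1) \<and>
    mat_adjoint S * A * S = mat_diag d (\<lambda>i. if i < k then 1 else 0)"
proof -
  have A: "A \<in> carrier_mat d d" using psd by (simp add: pos_semidef_def)
  obtain U t r where U: "unitary_mat d U" and AU: "A = U * mat_diag d (\<lambda>i. complex_of_real (t i)) * mat_adjoint U"
    and "r \<le> d" and pos: "\<And>i. i < r \<Longrightarrow> 0 < t i" and zero: "\<And>i. r \<le> i \<Longrightarrow> i < d \<Longrightarrow> t i = 0"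
    and ev: "nonzero_eigenvalues A = mset (map (\<lambda>i. complex_of_real (t i)) [0..<r])"
    using pos_semidef_spectral[OF psd] by metis
  note U' = unitary_matD[OF U]
  obtain ts :: "real list" where ts: "length ts = k" "nonzero_eigenvalues A = mset (map complex_of_real ts)"
    "(\<Sum>s\<leftarrow>ts. 1 / s) \<le> real k"
    using bound by (auto simp: inverse_trace_bound_def)
  \<comment> \<open>Taking real parts compares the given list with the spectral eigenvalues as
    multisets of reals; hence \<open>r = k\<close> and the sums of inverses agree.\<close>
  have "image_mset Re (nonzero_eigenvalues A) = mset ts"
    unfolding ts(2) mset_map[symmetric] map_map by (simp add: o_def)
  moreover have "image_mset Re (nonzero_eigenvalues A) = mset (map t [0..<r])"
    unfolding ev mset_map[symmetric] map_map by (simp add: o_def)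
  ultimately have mset_ts: "mset ts = mset (map t [0..<r])" by simp
  then have rk: "r = k" using ts(1) mset_eq_length by fastforce
  have "(\<Sum>s\<leftarrow>ts. 1 / s) = (\<Sum>s\<leftarrow>map t [0..<k]. 1 / s)"
    using mset_ts unfolding rk by (metis mset_map sum_mset_sum_list)
  also have "\<dots> = (\<Sum>i<k. 1 / t i)"
    by (simp add: sum_list_sum_nth o_def lessThan_atLeast0)
  finally have sum_le: "(\<Sum>i<k. 1 / t i) \<le> real k" using ts(3) by simp
  \<comment> \<open>The squared norm that the first \<open>k\<close> coordinates contribute to each
    of the first \<open>k\<close> columns of \<open>C\<close>; the trace bound says that it is at
    most 1.\<close>
  define c where "c = (\<Sum>i<k. 1 / t i) / real k"
  have c: "c \<le> 1" using sum_le k(1) by (simp add: c_def)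
  let ?D = "mat_diag d (\<lambda>i. complex_of_real (t i))"
  let ?P = "mat_diag d (\<lambda>i. if i < k then 1 else 0 :: complex)"
  \<comment> \<open>The upper left block is the unitary Fourier matrix with row \<open>a\<close>
    divided by \<open>sqrt (t a)\<close>. Row \<open>d - 1\<close> lies in the kernel part because
    \<open>k < d\<close>, and its entries fill the first \<open>k\<close> columns up to norm 1. The
    other columns are unit vectors.\<close>
  define C where "C = mat d d (\<lambda>(a, j).
    if j < k then
      if a < k then root_of_unity k j ^ a / complex_of_real (sqrt (real k * t a))
      else if a = d - 1 then complex_of_real (sqrt (1 - c)) else 0
    else if a = j then 1 else 0)"
  have C: "C \<in> carrier_mat d d" by (simp add: C_def)
  have form: "mat_adjoint C * (?D * C) = ?P"
  proof (rule eq_matI)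
    fix i j assume "i < dim_row ?P" "j < dim_col ?P"
    then have ij: "i < d" "j < d" by (auto simp: mat_diag_def)
    have "(mat_adjoint C * (?D * C)) $$ (i, j) = (\<Sum>a<d. cnj (C $$ (a, i)) * (t a * C $$ (a, j)))"
      using C ij by (auto simp: mat_diag_mult_left[of _ d d] scalar_prod_def lessThan_atLeast0 intro!: sum.cong)
    \<comment> \<open>Rows from \<open>k\<close> on carry eigenvalue 0, so the correction in row
      \<open>d - 1\<close> does not disturb the form.\<close>
    also have "\<dots> = (\<Sum>a<k. cnj (C $$ (a, i)) * (t a * C $$ (a, j)))"
      using k zero by (intro sum.mono_neutral_right) (auto simp: rk)
    also have "\<dots> = ?P $$ (i, j)"
    proof (cases "i < k \<and> j < k")
      case True
      have "(\<Sum>a<k. cnj (C $$ (a, i)) * (t a * C $$ (a, j))) = 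
          (\<Sum>a<k. 1 / of_nat k * (cnj (root_of_unity k i ^ a) * root_of_unity k j ^ a))"
      proof (rule sum.cong)
        fix a assume "a \<in> {..<k}"
        then have a: "a < k" "0 < t a" using pos by (auto simp: rk)
        have "complex_of_real (sqrt (real k * t a)) * complex_of_real (sqrt (real k * t a)) = complex_of_real (real k * t a)"
          using a(2) by (simp only: of_real_mult[symmetric] real_sqrt_mult_self) simp
        then show "cnj (C $$ (a, i)) * (t a * C $$ (a, j)) = 
            1 / of_nat k * (cnj (root_of_unity k i ^ a) * root_of_unity k j ^ a)"
          using True a ij k by (simp add: C_def field_simps)
      qed simp
      also have "\<dots> = 1 / of_nat k * (if i = j then of_nat k else 0)"
        unfolding sum_distrib_left[symmetric] using True by (simp only: sum_root_of_unity_powers)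
      finally show ?thesis using True k by (auto simp: mat_diag_def)
    next
      case False
      then have "cnj (C $$ (a, i)) * (t a * C $$ (a, j)) = 0" if "a < k" for a
        using that k ij by (auto simp: C_def)
      then have "(\<Sum>a<k. cnj (C $$ (a, i)) * (t a * C $$ (a, j))) = 0" by (intro sum.neutral) auto
      then show ?thesis using False ij by (auto simp: mat_diag_def)
    qed
    finally show "(mat_adjoint C * (?D * C)) $$ (i, j) = ?P $$ (i, j)" .
  qed (use C in \<open>auto simp: mat_diag_def\<close>)
  have norm_C: "cvec_norm (col C j) = 1" if j: "j < d" for j
  proof -
    have "(cvec_norm (col C j))\<^sup>2 = (\<Sum>a<d. (cmod (C $$ (a, j)))\<^sup>2)"
      using C j cvec_norm_power2[of "col C j" d] by (auto intro!: sum.cong)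
    also have "\<dots> = 1"
    proof (cases "j < k")
      case True
      have "(\<Sum>a<d. (cmod (C $$ (a, j)))\<^sup>2) = (\<Sum>a<k. (cmod (C $$ (a, j)))\<^sup>2) + (\<Sum>a\<in>{k..<d}. (cmod (C $$ (a, j)))\<^sup>2)"
        using k by (simp add: lessThan_atLeast0 sum.atLeastLessThan_concat)
      moreover have "(\<Sum>a<k. (cmod (C $$ (a, j)))\<^sup>2) = (\<Sum>a<k. (1 / t a) / real k)"
        using True j k pos by (intro sum.cong) (auto simp: rk C_def norm_divide norm_power power_divide less_imp_le mult.commute)
      moreover have "(\<Sum>a<k. (1 / t a) / real k) = c"
        by (simp add: c_def sum_divide_distrib)
      moreover have "(\<Sum>a\<in>{k..<d}. (cmod (C $$ (a, j)))\<^sup>2) = (\<Sum>a\<in>{k..<d}. if a = d - 1 then 1 - c else 0)"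
        using True j c by (intro sum.cong) (auto simp: C_def)
      moreover have "\<dots> = 1 - c" using k by (simp add: sum.delta)
      ultimately show ?thesis by simp
    next
      case False
      then have "(\<Sum>a<d. (cmod (C $$ (a, j)))\<^sup>2) = (\<Sum>a<d. if a = j then 1 else 0)"
        using j by (intro sum.cong) (auto simp: C_def)
      then show ?thesis using j by simp
    qed
    finally show ?thesis using cvec_norm_nonneg[of "col C j"] by (simp add: power2_eq_1_iff)
  qed
  \<comment> \<open>If \<open>C\<close> annihilates \<open>v\<close>, so does the projection
    \<open>?P\<close>, and the first \<open>k\<close> coordinates of \<open>v\<close> vanish. In the
    rows from \<open>k\<close> on, the remaining columns of \<open>C\<close> form an identity block,
    so the other coordinates vanish too.\<close>
  have "det C \<noteq> 0"
  proof
    assume "det C = 0"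
    then obtain v where v: "v \<in> carrier_vec d" "v \<noteq> 0\<^sub>v d" "C *\<^sub>v v = 0\<^sub>v d"
      using det_0_iff_vec_prod_zero_field[OF C] by auto
    have "?P *\<^sub>v v = mat_adjoint C *\<^sub>v (?D *\<^sub>v (C *\<^sub>v v))"
      unfolding form[symmetric] using C v(1)
      by (simp add: assoc_mult_mat_vec[of _ d d _ d] mult_carrier_mat[of _ d d])
    also have "\<dots> = 0\<^sub>v d"
      unfolding v(3) using C by (intro eq_vecI) (auto simp: mat_diag_def scalar_prod_def)
    finally have Pv: "?P *\<^sub>v v = 0\<^sub>v d" .
    have low: "v $ i = 0" if i: "i < k" for i
      using arg_cong[OF Pv, of "\<lambda>w. w $ i"] i k mat_diag_vec[OF v(1), of i "\<lambda>i. if i < k then 1 else 0"] by simp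
    have "v $ i = 0" if i: "i < d" for i
    proof (cases "i < k")
      case False
      have "(C *\<^sub>v v) $ i = (\<Sum>j<d. C $$ (i, j) * v $ j)"
        using C v(1) i by (auto simp: scalar_prod_def lessThan_atLeast0)
      also have "\<dots> = (\<Sum>j<d. if j = i then v $ j else 0)"
        using low False i by (intro sum.cong) (auto simp: C_def)
      finally show ?thesis using v(3) i by simp
    qed (rule low)
    then have "v = 0\<^sub>v d" using v(1) by (intro eq_vecI) auto
    with v(2) show False ..
  qed
  then have "det C \<noteq> 0" .
  then obtain C' where C': "C' \<in> carrier_mat d d" "C' * C = 1\<^sub>m d"
    using det_non_zero_imp_unit[OF C, of "()"] by (auto simp: Units_def ring_mat_def)
  define S where "S = U * C"
  have S: "S \<in> carrier_mat d d" using U'(1) C unfolding S_def by (intro mult_carrier_mat)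
  have "(C' * mat_adjoint U) * S = C' * (mat_adjoint U * U) * C"
    unfolding S_def using C C'(1) U'(1) 
    by (simp add: assoc_mult_mat[of _ d d _ d _ d] mult_carrier_mat[of _ d d _ d])
  also have "\<dots> = 1\<^sub>m d" using U' C' by simp
  finally have "invertible_mat S"
    using mat_inv_unique(1)[OF S, of "C' * mat_adjoint U"] U'(1) C'(1) by (auto intro: mult_carrier_mat[of _ d d])
  moreover have "cvec_norm (col S j) = 1" if "j < d" for j
    using norm_C[OF that] cvec_norm_unitary_mult[OF U, of "col C j"] U'(1) C that
    by (simp add: S_def col_mult2[of _ d d _ d] del: col_mult)
  moreover have "mat_adjoint S * A * S = ?P"
  proof -
    have "mat_adjoint U * A * U = ?D"
      unfolding AU using U' by (intro mat_inverse_mult[of _ d]) auto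
    moreover have "mat_adjoint S * A * S = mat_adjoint C * ((mat_adjoint U * A * U) * C)"
      unfolding S_def using U'(1) A C
      by (simp add: mat_adjoint_mult[of _ d d _ d] assoc_mult_mat[of _ d d _ d _ d] mult_carrier_mat[of _ d d _ d])
    ultimately show ?thesis using form by simp
  qed
  ultimately show ?thesis using S by blast
qed

text \<open>The implications run from (i) and from (ii) to (iii), on to (iv), and from there back to
  (i) and (ii) together.\<close>

theorem theorem3:
  fixes l d k :: nat
    and L :: "(nat \<Rightarrow> complex) \<Rightarrow> complex"
    and A :: "complex mat"
  assumes "1 \<le> l" and "l < d" and "k = d - l"
    and "banach_limit L"
    and "pos_semidef d A" and "\<not> invertible_mat A"
  shows
    "((\<exists>T \<in> carrier_mat d d. powerbounded T \<and> l_stable l T \<and> has_cesaro_asymptotic_limit T A)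
      \<longleftrightarrow>
      (\<exists>T \<in> carrier_mat d d. powerbounded T \<and> l_stable l T \<and> asymptotic_limit L T = A))
     \<and>
     ((\<exists>T \<in> carrier_mat d d. powerbounded T \<and> l_stable l T \<and> asymptotic_limit L T = A)
      \<longleftrightarrow>
      (\<exists>ts :: real list. length ts = k \<and>
         nonzero_eigenvalues A = mset (map complex_of_real ts) \<and>
         (\<Sum>t\<leftarrow>ts. 1 / t) \<le> real k))
     \<and>
     ((\<exists>ts :: real list. length ts = k \<and>
         nonzero_eigenvalues A = mset (map complex_of_real ts) \<and>
         (\<Sum>t\<leftarrow>ts. 1 / t) \<le> real k)
      \<longleftrightarrow>
      (\<exists>S \<in> carrier_mat d d. invertible_mat S \<and> (\<forall>j<d. cvec_norm (col S j) = 1) \<and>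
         A = mat_inv (mat_adjoint S) * diag_block_mat [1\<^sub>m k, 0\<^sub>m l l] * mat_inv S))"
proof -
  let ?C = "\<lambda>s a. (\<lambda>n. 1 / complex_of_nat n * (\<Sum>j<n. s j)) \<longlonglongrightarrow> a"
  let ?B = "\<lambda>s a. Bseq s \<and> L s = a"
  let ?P = "mat_diag d (\<lambda>i. if i < k then 1 else 0 :: complex)"
  let ?i = "\<exists>T \<in> carrier_mat d d. powerbounded T \<and> l_stable l T \<and> has_cesaro_asymptotic_limit T A"
  let ?ii = "\<exists>T \<in> carrier_mat d d. powerbounded T \<and> l_stable l T \<and> asymptotic_limit L T = A"
  let ?iv = "\<exists>S \<in> carrier_mat d d. invertible_mat S \<and> (\<forall>j<d. cvec_norm (col S j) = 1) \<and>
         A = mat_inv (mat_adjoint S) * diag_block_mat [1\<^sub>m k, 0\<^sub>m l l] * mat_inv S"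
  have A: "A \<in> carrier_mat d d" using assms(5) by (simp add: pos_semidef_def)
  have k: "0 < k" "k < d" "d - l = k" "d - k = l" "k + l = d" using assms(1-3) by auto
  note B = banach_generalized_mean[OF assms(4)]
  \<comment> \<open>Stated for an arbitrary mean, so that one argument covers both (i) and
    (ii).\<close>
  have bound: "inverse_trace_bound k A"
    if "generalized_mean M" "T \<in> carrier_mat d d" "powerbounded T" "l_stable l T" "orbit_limit M d T A" for M T
  proof -
    interpret mean_orbit_limit M d T A
      using that by (intro mean_orbit_limit.intro mean_orbit_limit_axioms.intro)
    show ?thesis using inverse_trace_boundI[OF that(4)] assms(2) k by simp
  qed
  have i_iii: "?i \<Longrightarrow> inverse_trace_bound k A"
    using bound[OF cesaro_generalized_mean] has_cesaro_asymptotic_limit_iff[OF _ A] by blast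
  have ii_iii: "?ii \<Longrightarrow> inverse_trace_bound k A"
    using bound[OF B] asymptotic_limit_eq_iff[OF assms(4)] by blast
  have iii_iv: ?iv if iii: "inverse_trace_bound k A"
  proof -
    obtain S where S: "S \<in> carrier_mat d d" "invertible_mat S" "\<And>j. j < d \<Longrightarrow> cvec_norm (col S j) = 1"
      and P: "mat_adjoint S * A * S = ?P"
      using normalized_basis_of_inverse_trace_bound[OF assms(5) iii k(1,2)] by auto
    note I = mat_inv_inverse[OF S(1,2)]
    have "mat_adjoint (mat_inv S) * (mat_adjoint S * A * S) * mat_inv S = A"
      using S(1) A I mat_adjoint_mult[OF S(1) I(1)] by (intro mat_inverse_mult[of _ d]) auto
    then have "A = mat_inv (mat_adjoint S) * ?P * mat_inv S"
      unfolding P mat_inv_adjoint(2)[OF S(1,2)] by simp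
    then show ?iv using S unfolding diag_block_one_zero_mat k(5) by blast
  qed
  \<comment> \<open>A single \<open>T\<close> realizes both limits, since its orbit limit is
    \<open>A\<close> for every generalized mean.\<close>
  have iv_i_ii: "?i \<and> ?ii" if iv: ?iv
  proof -
    obtain S where S: "S \<in> carrier_mat d d" "invertible_mat S" "\<And>j. j < d \<Longrightarrow> cvec_norm (col S j) = 1"
      and AS: "A = mat_inv (mat_adjoint S) * ?P * mat_inv S"
      using iv unfolding diag_block_one_zero_mat k(5) by blast
    note I = mat_inv_inverse[OF S(1,2)]
    interpret nb: normalized_basis d k S "mat_inv S"
      using S I k by unfold_locales auto
    have nbA: "nb.A = A" unfolding nb.A_def AS mat_inv_adjoint(2)[OF S(1,2)] ..
    have "l_stable l nb.T" using nb.l_stable_T[OF B] k by simp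
    then show ?thesis
      using nb.T nb.powerbounded nb.orbit_limit_T[OF B] nb.orbit_limit_T[OF cesaro_generalized_mean]
        has_cesaro_asymptotic_limit_iff[OF nb.T A] asymptotic_limit_eq_iff[OF assms(4) nb.T nb.powerbounded]
      unfolding nbA by blast
  qed
  show ?thesis
    using i_iii ii_iii iii_iv iv_i_ii unfolding inverse_trace_bound_def by argo
qed

end
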